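(* Let $p\ge 3$ be a prime, let $a,b\in\mathcal{E}_p$ with $b\ne 1$, let $$g_{a,b}(u)=a\left(\frac{b^2u^2+1}{b^2+u^2}\right),$$ and let $x_0$ be the unique fixed point of $g_{a,b}$ in $\mathcal{E}_p$. Put $$K=\{x\in S_1(x_0):\ |x^2+1|_p\le |b^2-1|_p\},\qquad R=\bigcap_{n\ge 0} g_{a,b}^{-n}(K)=\{x\in\mathbb{Q}_p:\ g_{a,b}^n(x)\in K\ \text{for all } n\ge 0\}.$$ Then $$A(x_0)=\mathbb{Q}_p\setminus R .$$ Moreover, $R$ is nonempty if and only if $p\equiv 1\pmod 4$.
   Context: $\mathbb{Q}_p$ is the field of $p$-adic numbers with the $p$-adic absolute value $|\cdot|_p$ normalized by $|p|_p=1/p$. $\mathcal{E}_p=\{x\in\mathbb{Q}_p:\ |x-1|_p<1\}$ and $S_1(x_0)=\{x\in\mathbb{Q}_p:\ |x-x_0|_p=1\}$. The rational function $g_{a,b}$ is iterated as a map of $\mathbb{Q}_p\cup\{\infty\}$, with $g_{a,b}(u)=\infty$ when $u^2=-b^2$ and $g_{a,b}(\infty)=ab^2$; $g_{a,b}^n$ denotes the $n$-fold iterate ($g_{a,b}^0$ is the identity). The basin of attraction of $x_0$ is $A(x_0)=\{x\in\mathbb{Q}_p:\ g_{a,b}^n(x)\to x_0 \text{ as } n\to\infty\}$, where convergence means that $g_{a,b}^n(x)\in\mathbb{Q}_p$ for all large $n$ and $|g_{a,b}^n(x)-x_0|_p\to 0$. *)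

theory Defs
  imports Complex_Main "HOL-Computational_Algebra.Squarefree" "Berlekamp_Zassenhaus.Finite_Field"
begin

section \<open>The \<open>p\<close>-adic absolute value on the rationals\<close>

definition rat_padic_abs :: "nat \<Rightarrow> rat \<Rightarrow> real" where
  "rat_padic_abs p x =
     (if x = 0 then 0
      else real p powi (int (multiplicity (int p) (snd (quotient_of x)))
                      - int (multiplicity (int p) (fst (quotient_of x)))))"

lemma rat_padic_abs_0 [simp]: "rat_padic_abs p 0 = 0"
  by (simp add: rat_padic_abs_def)

lemma rat_padic_abs_frac:
  assumes p: "prime p" and ab: "a \<noteq> 0" "b \<noteq> 0"
  shows "rat_padic_abs p (of_int a / of_int b) =
    real p powi (int (multiplicity (int p) b) - int (multiplicity (int p) a))"
proof -
  define x :: rat where "x = of_int a / of_int b"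
  obtain n d where q: "quotient_of x = (n, d)" by (cases "quotient_of x")
  have d: "d > 0" using q by (rule quotient_of_denom_pos)
  have xnd: "x = of_int n / of_int d" using q by (rule quotient_of_div)
  have x0: "x \<noteq> 0" using ab by (simp add: x_def)
  hence n: "n \<noteq> 0" using xnd by auto
  have "of_int a * of_int d = (of_int n * of_int b :: rat)"
    using xnd d ab by (simp add: x_def field_simps)
  hence "a * d = n * b" by (metis of_int_eq_iff of_int_mult)
  hence "multiplicity (int p) (a * d) = multiplicity (int p) (n * b)" by simp
  hence "multiplicity (int p) a + multiplicity (int p) d
       = multiplicity (int p) n + multiplicity (int p) b"
    using p ab n d by (simp add: prime_elem_multiplicity_mult_distrib)
  hence "int (multiplicity (int p) d) - int (multiplicity (int p) n) =
         int (multiplicity (int p) b) - int (multiplicity (int p) a)" by linarith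
  thus ?thesis using x0 q by (simp add: rat_padic_abs_def flip: x_def)
qed

lemma rat_as_frac:
  fixes x :: rat
  obtains a b :: int where "x = of_int a / of_int b" "b \<noteq> 0"
proof -
  obtain n d where q: "quotient_of x = (n, d)" by (cases "quotient_of x")
  show ?thesis using that[of n d] quotient_of_denom_pos[OF q] quotient_of_div[OF q] by auto
qed

lemma rat_padic_abs_pos: "prime p \<Longrightarrow> x \<noteq> 0 \<Longrightarrow> rat_padic_abs p x > 0"
  by (simp add: rat_padic_abs_def prime_gt_0_nat)

lemma rat_padic_abs_nonneg [simp]: "rat_padic_abs p x \<ge> 0"
  by (simp add: rat_padic_abs_def)

lemma rat_padic_abs_eq_0_iff: "prime p \<Longrightarrow> rat_padic_abs p x = 0 \<longleftrightarrow> x = 0"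
  using rat_padic_abs_pos[of p x] by (cases "x = 0") auto

lemma rat_padic_abs_mult:
  assumes p: "prime p"
  shows "rat_padic_abs p (x * y) = rat_padic_abs p x * rat_padic_abs p y"
proof (cases "x = 0 \<or> y = 0")
  case False
  obtain a b where x: "x = of_int a / of_int b" "b \<noteq> 0" by (rule rat_as_frac)
  obtain c d where y: "y = of_int c / of_int d" "d \<noteq> 0" by (rule rat_as_frac)
  have a: "a \<noteq> 0" and c: "c \<noteq> 0" using False x y by auto
  have xy: "x * y = of_int (a * c) / of_int (b * d)" using x y by simp
  have p0: "real p \<noteq> 0" using p by auto
  show ?thesis
    unfolding xy using x y a c p p0
    by (subst rat_padic_abs_frac)
       (auto simp: rat_padic_abs_frac prime_elem_multiplicity_mult_distrib
         simp flip: power_int_add intro!: arg_cong[where f = "(powi) (real p)"])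
qed auto

lemma rat_padic_abs_1 [simp]: "rat_padic_abs p 1 = 1"
  by (simp add: rat_padic_abs_def)

lemma rat_padic_abs_uminus [simp]: "rat_padic_abs p (- x) = rat_padic_abs p x"
  by (simp add: rat_padic_abs_def rat_uminus_code split: prod.splits)

lemma rat_padic_abs_commute: "rat_padic_abs p (x - y) = rat_padic_abs p (y - x)"
  by (metis minus_diff_eq rat_padic_abs_uminus)

lemma rat_padic_abs_inverse:
  assumes "prime p"
  shows "rat_padic_abs p (inverse x) = inverse (rat_padic_abs p x)"
proof (cases "x = 0")
  case False
  hence "rat_padic_abs p (inverse x) * rat_padic_abs p x = 1"
    using rat_padic_abs_mult[OF assms, of "inverse x" x] by simp
  thus ?thesis by (metis inverse_unique mult.commute)
qed auto

lemma rat_padic_abs_prime: "prime p \<Longrightarrow> rat_padic_abs p (of_nat p) = 1 / real p"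
  using rat_padic_abs_frac[of p "int p" 1]
  by (simp add: power_int_minus field_simps prime_gt_0_nat)

lemma rat_padic_abs_ultra:
  assumes p: "prime p"
  shows "rat_padic_abs p (x + y) \<le> max (rat_padic_abs p x) (rat_padic_abs p y)"
proof (cases "x = 0 \<or> y = 0 \<or> x + y = 0")
  case False
  obtain a0 b0 where x: "x = of_int a0 / of_int b0" "b0 \<noteq> 0" by (rule rat_as_frac)
  obtain c0 d0 where y: "y = of_int c0 / of_int d0" "d0 \<noteq> 0" by (rule rat_as_frac)
  define a b c where "a = a0 * d0" and "b = b0 * d0" and "c = c0 * b0"
  have b: "b \<noteq> 0" using x y by (simp add: b_def)
  have xa: "x = of_int a / of_int b" and yc: "y = of_int c / of_int b"
    using x y by (simp_all add: a_def b_def c_def)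
  have xy: "x + y = of_int (a + c) / of_int b"
    by (simp add: xa yc add_divide_distrib)
  have a: "a \<noteq> 0" and c: "c \<noteq> 0" and ac: "a + c \<noteq> 0"
    using False xa yc xy by auto
  let ?m = "multiplicity (int p)"
  have "int p ^ min (?m a) (?m c) dvd a + c"
    by (intro dvd_add multiplicity_dvd') simp_all
  hence m: "min (?m a) (?m c) \<le> ?m (a + c)"
    using p ac by (intro multiplicity_geI) (auto dest: prime_nat_not_dvd)
  have "real p \<ge> 1" using p by (simp add: Suc_leI prime_gt_0_nat)
  hence mono: "real p powi i \<le> real p powi j" if "i \<le> j" for i j
    using that by (intro power_int_increasing) auto
  show ?thesis
    unfolding xy rat_padic_abs_frac[OF p ac b]
    unfolding xa yc rat_padic_abs_frac[OF p a b] rat_padic_abs_frac[OF p c b]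
    using m by (auto simp: le_max_iff_disj min_def split: if_splits intro!: mono)
qed (auto simp: le_max_iff_disj)

lemma rat_padic_abs_ultra_diff:
  assumes p: "prime p"
  shows "rat_padic_abs p (x - y) \<le> max (rat_padic_abs p x) (rat_padic_abs p y)"
  using rat_padic_abs_ultra[OF p, of x "- y"] by simp

lemma rat_padic_abs_triangle:
  assumes p: "prime p"
  shows "rat_padic_abs p (x + y) \<le> rat_padic_abs p x + rat_padic_abs p y"
  using rat_padic_abs_ultra[OF p, of x y] rat_padic_abs_nonneg[of p x] rat_padic_abs_nonneg[of p y]
  by linarith

lemma rat_padic_abs_diff_abs:
  assumes p: "prime p"
  shows "\<bar>rat_padic_abs p x - rat_padic_abs p y\<bar> \<le> rat_padic_abs p (x - y)"
  using rat_padic_abs_triangle[OF p, of "x - y" y] rat_padic_abs_triangle[OF p, of "y - x" x]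
    rat_padic_abs_commute[of p x y] by simp

lemma rat_padic_abs_eqI:
  assumes p: "prime p" and "rat_padic_abs p (x - y) < rat_padic_abs p y"
  shows "rat_padic_abs p x = rat_padic_abs p y"
  using rat_padic_abs_ultra[OF p, of "x - y" y] rat_padic_abs_ultra[OF p, of "y - x" x]
    rat_padic_abs_commute[of p x y] assms(2) by simp


section \<open>Cauchy sequences and null sequences for the \<open>p\<close>-adic absolute value\<close>

definition padic_Cauchy :: "nat \<Rightarrow> (nat \<Rightarrow> rat) \<Rightarrow> bool" where
  "padic_Cauchy p X \<longleftrightarrow> (\<forall>e>0. \<exists>N. \<forall>m\<ge>N. \<forall>n\<ge>N. rat_padic_abs p (X m - X n) < e)"

definition padic_null :: "nat \<Rightarrow> (nat \<Rightarrow> rat) \<Rightarrow> bool" where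
  "padic_null p X \<longleftrightarrow> (\<lambda>n. rat_padic_abs p (X n)) \<longlonglongrightarrow> 0"

definition padic_rel :: "nat \<Rightarrow> (nat \<Rightarrow> rat) \<Rightarrow> (nat \<Rightarrow> rat) \<Rightarrow> bool" where
  "padic_rel p X Y \<longleftrightarrow> padic_Cauchy p X \<and> padic_Cauchy p Y \<and> padic_null p (\<lambda>n. X n - Y n)"

lemma padic_CauchyE:
  assumes "padic_Cauchy p X" "e > 0"
  obtains N where "\<And>m n. m \<ge> N \<Longrightarrow> n \<ge> N \<Longrightarrow> rat_padic_abs p (X m - X n) < e"
  using assms unfolding padic_Cauchy_def by blast

lemma padic_null_0 [simp]: "padic_null p (\<lambda>n. 0)"
  by (simp add: padic_null_def)

lemma padic_null_cmult:
  assumes p: "prime p" and X: "padic_null p X" and B: "\<And>n. rat_padic_abs p (Y n) \<le> B"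
  shows "padic_null p (\<lambda>n. X n * Y n)"
  unfolding padic_null_def
proof (rule tendsto_sandwich[OF _ _ tendsto_const])
  show "(\<lambda>n. rat_padic_abs p (X n) * B) \<longlonglongrightarrow> 0"
    using tendsto_mult_right[of _ 0 sequentially B] X by (simp add: padic_null_def)
qed (auto simp: rat_padic_abs_mult[OF p] intro!: always_eventually mult_left_mono B)

lemma padic_null_add:
  assumes p: "prime p" and X: "padic_null p X" and Y: "padic_null p Y"
  shows "padic_null p (\<lambda>n. X n + Y n)"
  unfolding padic_null_def
proof (rule tendsto_sandwich[OF _ _ tendsto_const])
  show "(\<lambda>n. rat_padic_abs p (X n) + rat_padic_abs p (Y n)) \<longlonglongrightarrow> 0"
    using tendsto_add[of _ 0 sequentially _ 0] X Y by (simp add: padic_null_def)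
qed (auto simp: rat_padic_abs_triangle[OF p])

lemma padic_null_uminus: "padic_null p (\<lambda>n. - X n) \<longleftrightarrow> padic_null p X"
  by (simp add: padic_null_def)

lemma padic_null_commute: "padic_null p (\<lambda>n. X n - Y n) \<longleftrightarrow> padic_null p (\<lambda>n. Y n - X n)"
  by (simp add: padic_null_def rat_padic_abs_commute)

lemma padic_null_eventually:
  assumes "eventually (\<lambda>n. X n = Y n) sequentially"
  shows "padic_null p X \<longleftrightarrow> padic_null p Y"
  unfolding padic_null_def
  by (rule tendsto_cong) (use assms in eventually_elim, simp)

lemma padic_Cauchy_const [simp]: "padic_Cauchy p (\<lambda>n. c)"
  by (simp add: padic_Cauchy_def)

lemma padic_Cauchy_uminus: "padic_Cauchy p X \<Longrightarrow> padic_Cauchy p (\<lambda>n. - X n)"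
  by (simp add: padic_Cauchy_def rat_padic_abs_commute)

lemma padic_Cauchy_add:
  assumes p: "prime p" and X: "padic_Cauchy p X" and Y: "padic_Cauchy p Y"
  shows "padic_Cauchy p (\<lambda>n. X n + Y n)"
  unfolding padic_Cauchy_def
proof safe
  fix e :: real assume e: "e > 0"
  obtain M where M: "\<And>m n. m \<ge> M \<Longrightarrow> n \<ge> M \<Longrightarrow> rat_padic_abs p (X m - X n) < e"
    using padic_CauchyE[OF X e] by blast
  obtain N where N: "\<And>m n. m \<ge> N \<Longrightarrow> n \<ge> N \<Longrightarrow> rat_padic_abs p (Y m - Y n) < e"
    using padic_CauchyE[OF Y e] by blast
  have "rat_padic_abs p ((X m + Y m) - (X n + Y n)) < e"
    if "m \<ge> max M N" "n \<ge> max M N" for m n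
  proof -
    have "rat_padic_abs p ((X m - X n) + (Y m - Y n)) < e"
      using rat_padic_abs_ultra[OF p, of "X m - X n" "Y m - Y n"] M[of m n] N[of m n] that
      by linarith
    thus ?thesis by (simp only: add_diff_add)
  qed
  thus "\<exists>N. \<forall>m\<ge>N. \<forall>n\<ge>N. rat_padic_abs p (X m + Y m - (X n + Y n)) < e" by blast
qed

lemma padic_Cauchy_bounded:
  assumes p: "prime p" and X: "padic_Cauchy p X"
  obtains B where "B > 0" "\<And>n. rat_padic_abs p (X n) \<le> B"
proof -
  obtain N where N: "\<And>m n. m \<ge> N \<Longrightarrow> n \<ge> N \<Longrightarrow> rat_padic_abs p (X m - X n) < 1"
    using padic_CauchyE[OF X zero_less_one] by blast
  define B where "B = 1 + (\<Sum>i\<le>N. rat_padic_abs p (X i))"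
  have le: "rat_padic_abs p (X i) \<le> B - 1" if "i \<le> N" for i
    using that by (auto simp: B_def intro!: member_le_sum)
  have B: "B \<ge> 1" using le[of 0] rat_padic_abs_nonneg[of p "X 0"] by linarith
  have "rat_padic_abs p (X n) \<le> B" for n
  proof (cases "n \<le> N")
    case False
    have "rat_padic_abs p (X n) \<le> rat_padic_abs p (X n - X N) + rat_padic_abs p (X N)"
      using rat_padic_abs_triangle[OF p, of "X n - X N" "X N"] by simp
    thus ?thesis using N[of n N] le[of N] False by simp
  qed (use le in force)
  thus ?thesis using that[of B] B by simp
qed

lemma padic_Cauchy_mult:
  assumes p: "prime p" and X: "padic_Cauchy p X" and Y: "padic_Cauchy p Y"
  shows "padic_Cauchy p (\<lambda>n. X n * Y n)"
  unfolding padic_Cauchy_def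
proof safe
  fix e :: real assume e: "e > 0"
  obtain A where A: "A > 0" "\<And>n. rat_padic_abs p (X n) \<le> A"
    using padic_Cauchy_bounded[OF p X] by blast
  obtain B where B: "B > 0" "\<And>n. rat_padic_abs p (Y n) \<le> B"
    using padic_Cauchy_bounded[OF p Y] by blast
  obtain M where M: "\<And>m n. m \<ge> M \<Longrightarrow> n \<ge> M \<Longrightarrow> rat_padic_abs p (X m - X n) < e / B"
    using padic_CauchyE[OF X, of "e / B"] e B(1) by (metis divide_pos_pos)
  obtain N where N: "\<And>m n. m \<ge> N \<Longrightarrow> n \<ge> N \<Longrightarrow> rat_padic_abs p (Y m - Y n) < e / A"
    using padic_CauchyE[OF Y, of "e / A"] e A(1) by (metis divide_pos_pos)
  have "rat_padic_abs p (X m * Y m - X n * Y n) < e"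
    if mn: "m \<ge> max M N" "n \<ge> max M N" for m n
  proof -
    have eq: "X m * Y m - X n * Y n = (X m - X n) * Y m + X n * (Y m - Y n)"
      by (simp add: algebra_simps)
    have "rat_padic_abs p (X m - X n) * rat_padic_abs p (Y m) \<le> rat_padic_abs p (X m - X n) * B"
      by (intro mult_left_mono B) auto
    also have "\<dots> < e" using M[of m n] mn B by (simp add: field_simps)
    finally have 1: "rat_padic_abs p ((X m - X n) * Y m) < e" by (simp add: rat_padic_abs_mult[OF p])
    have "rat_padic_abs p (X n) * rat_padic_abs p (Y m - Y n) \<le> A * rat_padic_abs p (Y m - Y n)"
      by (intro mult_right_mono A) auto
    also have "\<dots> < e" using N[of m n] mn A by (simp add: field_simps)
    finally have 2: "rat_padic_abs p (X n * (Y m - Y n)) < e" by (simp add: rat_padic_abs_mult[OF p])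
    show ?thesis unfolding eq
      using rat_padic_abs_ultra[OF p, of "(X m - X n) * Y m" "X n * (Y m - Y n)"] 1 2 by simp
  qed
  thus "\<exists>N. \<forall>m\<ge>N. \<forall>n\<ge>N. rat_padic_abs p (X m * Y m - X n * Y n) < e" by blast
qed

lemma padic_Cauchy_not_null:
  assumes p: "prime p" and X: "padic_Cauchy p X" and nn: "\<not> padic_null p X"
  obtains c N where "c > 0" "\<And>n. n \<ge> N \<Longrightarrow> rat_padic_abs p (X n) = c"
proof -
  obtain e where e: "e > 0" "\<And>N. \<exists>n\<ge>N. rat_padic_abs p (X n) \<ge> e"
    using nn by (auto simp: padic_null_def LIMSEQ_iff not_less)
  obtain N where N: "\<And>m n. m \<ge> N \<Longrightarrow> n \<ge> N \<Longrightarrow> rat_padic_abs p (X m - X n) < e"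
    using padic_CauchyE[OF X e(1)] by blast
  obtain m where m: "m \<ge> N" "rat_padic_abs p (X m) \<ge> e" using e by blast
  show ?thesis
  proof (rule that)
    show "rat_padic_abs p (X m) > 0" using m e by linarith
    show "rat_padic_abs p (X n) = rat_padic_abs p (X m)" if "n \<ge> N" for n
      using N[of n m] m that by (intro rat_padic_abs_eqI[OF p]) auto
  qed
qed

lemma padic_Cauchy_inverse:
  assumes p: "prime p" and X: "padic_Cauchy p X" and nn: "\<not> padic_null p X"
  shows "padic_Cauchy p (\<lambda>n. inverse (X n))"
  unfolding padic_Cauchy_def
proof safe
  fix e :: real assume e: "e > 0"
  obtain c M where c: "c > 0" "\<And>n. n \<ge> M \<Longrightarrow> rat_padic_abs p (X n) = c"
    using padic_Cauchy_not_null[OF p X nn] by blast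
  obtain N where N: "\<And>m n. m \<ge> N \<Longrightarrow> n \<ge> N \<Longrightarrow> rat_padic_abs p (X m - X n) < e * c * c"
    using padic_CauchyE[OF X, of "e * c * c"] e c(1) by (metis mult_pos_pos)
  have "rat_padic_abs p (inverse (X m) - inverse (X n)) < e"
    if mn: "m \<ge> max M N" "n \<ge> max M N" for m n
  proof -
    have nz: "X m \<noteq> 0" "X n \<noteq> 0" using c(1) c(2)[of m] c(2)[of n] mn by auto
    have "rat_padic_abs p (inverse (X m) - inverse (X n)) =
      inverse c * rat_padic_abs p (X m - X n) * inverse c"
      using nz c(2)[of m] c(2)[of n] mn
      by (simp add: inverse_diff_inverse rat_padic_abs_mult[OF p] rat_padic_abs_inverse[OF p])
    also have "\<dots> < e" using N[of m n] mn c(1) by (simp add: field_simps)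
    finally show ?thesis .
  qed
  thus "\<exists>N. \<forall>m\<ge>N. \<forall>n\<ge>N. rat_padic_abs p (inverse (X m) - inverse (X n)) < e" by blast
qed

lemma padic_null_cong:
  assumes p: "prime p" and XY: "padic_null p (\<lambda>n. X n - Y n)"
  shows "padic_null p X \<longleftrightarrow> padic_null p Y"
  using padic_null_add[OF p XY, of Y] padic_null_add[OF p XY[unfolded padic_null_commute[of p X]], of X]
  by auto

lemma padic_null_inverse_diff:
  assumes p: "prime p" and X: "padic_Cauchy p X" "\<not> padic_null p X"
    and Y: "padic_Cauchy p Y" "\<not> padic_null p Y" and XY: "padic_null p (\<lambda>n. X n - Y n)"
  shows "padic_null p (\<lambda>n. inverse (X n) - inverse (Y n))"
proof -
  obtain c M where c: "c > 0" "\<And>n. n \<ge> M \<Longrightarrow> rat_padic_abs p (X n) = c"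
    using padic_Cauchy_not_null[OF p X] by blast
  obtain d N where d: "d > 0" "\<And>n. n \<ge> N \<Longrightarrow> rat_padic_abs p (Y n) = d"
    using padic_Cauchy_not_null[OF p Y] by blast
  obtain B where "\<And>n. rat_padic_abs p (inverse (X n)) \<le> B"
    using padic_Cauchy_bounded[OF p padic_Cauchy_inverse[OF p X]] by blast
  hence 1: "padic_null p (\<lambda>n. (X n - Y n) * inverse (X n))" by (rule padic_null_cmult[OF p XY])
  obtain C where "\<And>n. rat_padic_abs p (inverse (Y n)) \<le> C"
    using padic_Cauchy_bounded[OF p padic_Cauchy_inverse[OF p Y]] by blast
  hence "padic_null p (\<lambda>n. (X n - Y n) * inverse (X n) * inverse (Y n))"
    by (rule padic_null_cmult[OF p 1])
  hence 2: "padic_null p (\<lambda>n. - ((X n - Y n) * inverse (X n) * inverse (Y n)))"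
    by (simp only: padic_null_uminus)
  have "eventually (\<lambda>n. inverse (X n) - inverse (Y n)
           = - ((X n - Y n) * inverse (X n) * inverse (Y n))) sequentially"
    using eventually_ge_at_top[of "max M N"]
  proof eventually_elim
    case (elim n)
    hence "X n \<noteq> 0" "Y n \<noteq> 0" using c(1) c(2)[of n] d(1) d(2)[of n] by auto
    thus ?case by (simp add: field_simps)
  qed
  from padic_null_eventually[OF this] 2 show ?thesis by simp
qed

lemma padic_abs_convergent:
  assumes p: "prime p" and X: "padic_Cauchy p X"
  shows "convergent (\<lambda>n. rat_padic_abs p (X n))"
proof (cases "padic_null p X")
  case True
  thus ?thesis by (auto simp: padic_null_def convergent_def)
next
  case False
  then obtain c N where "\<And>n. n \<ge> N \<Longrightarrow> rat_padic_abs p (X n) = c"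
    using padic_Cauchy_not_null[OF p X] by blast
  hence "(\<lambda>n. rat_padic_abs p (X n)) \<longlonglongrightarrow> c"
    by (intro tendsto_eventually) (auto simp: eventually_sequentially)
  thus ?thesis by (auto simp: convergent_def)
qed

lemma padic_rel_abs:
  assumes p: "prime p" and XY: "padic_rel p X Y"
  shows "lim (\<lambda>n. rat_padic_abs p (X n)) = lim (\<lambda>n. rat_padic_abs p (Y n))"
proof -
  from XY have X: "padic_Cauchy p X" and Y: "padic_Cauchy p Y"
    and N: "padic_null p (\<lambda>n. X n - Y n)" by (auto simp: padic_rel_def)
  have "(\<lambda>n. \<bar>rat_padic_abs p (X n) - rat_padic_abs p (Y n)\<bar>) \<longlonglongrightarrow> 0"
    by (rule tendsto_sandwich[OF _ _ tendsto_const N[unfolded padic_null_def]])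
       (auto simp: rat_padic_abs_diff_abs[OF p])
  hence "(\<lambda>n. rat_padic_abs p (X n) - rat_padic_abs p (Y n)) \<longlonglongrightarrow> 0"
    by (simp only: tendsto_rabs_zero_iff)
  moreover have "(\<lambda>n. rat_padic_abs p (X n) - rat_padic_abs p (Y n)) \<longlonglongrightarrow>
     lim (\<lambda>n. rat_padic_abs p (X n)) - lim (\<lambda>n. rat_padic_abs p (Y n))"
    using padic_abs_convergent[OF p X] padic_abs_convergent[OF p Y]
    by (intro tendsto_diff) (auto simp: convergent_LIMSEQ_iff)
  ultimately show ?thesis using LIMSEQ_unique by fastforce
qed

lemma part_equivp_padic_rel:
  assumes p: "prime p"
  shows "part_equivp (padic_rel p)"
proof (rule part_equivpI)
  show "\<exists>X. padic_rel p X X" by (rule exI[of _ "\<lambda>_. 0"]) (simp add: padic_rel_def)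
  show "symp (padic_rel p)"
    using padic_null_commute by (auto simp: symp_def padic_rel_def)
  show "transp (padic_rel p)"
  proof (rule transpI)
    fix X Y Z assume "padic_rel p X Y" "padic_rel p Y Z"
    thus "padic_rel p X Z"
      using padic_null_add[OF p, of "\<lambda>n. X n - Y n" "\<lambda>n. Y n - Z n"]
      by (auto simp: padic_rel_def)
  qed
qed


section \<open>The field of \<open>p\<close>-adic numbers\<close>

text \<open>
  \<open>'p padic\<close> is the completion of the rationals with respect to the \<open>p\<close>-adic absolute value,
  i.e. Cauchy sequences modulo null sequences. The prime \<open>p\<close> is carried by the index type:
  \<open>p = CARD('p)\<close>.
\<close>

typedef (overloaded) 'p padic =
  "{S. \<exists>X. padic_rel CARD('p::prime_card) X X \<and> S = Collect (padic_rel CARD('p) X)}"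
  using part_equivp_padic_rel[OF prime_card] by (auto simp: part_equivp_def)

definition Padic :: "(nat \<Rightarrow> rat) \<Rightarrow> 'p::prime_card padic" where
  "Padic X = Abs_padic (Collect (padic_rel CARD('p) X))"

definition rep_padic :: "'p::prime_card padic \<Rightarrow> nat \<Rightarrow> rat" where
  "rep_padic x = (SOME X. X \<in> Rep_padic x)"

text \<open>
  Lifting is set up by hand because \<open>quotient_type\<close> does not support a relation that depends on a
  type variable absent from the raw type.
\<close>

definition cr_padic :: "(nat \<Rightarrow> rat) \<Rightarrow> 'p::prime_card padic \<Rightarrow> bool" where
  "cr_padic X x \<longleftrightarrow> padic_rel CARD('p) X X \<and> Padic X = x"

lemma Quotient_padic:
  "Quotient (padic_rel CARD('p)) Padic rep_padic (cr_padic :: _ \<Rightarrow> 'p::prime_card padic \<Rightarrow> bool)"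
proof -
  let ?R = "padic_rel CARD('p)"
  note part_equivp = part_equivp_padic_rel[OF prime_card[where 'a = 'p]]
  note sym = part_equivp_symp[OF part_equivp] and trans = part_equivp_transp[OF part_equivp]
  have Collect_eq: "Collect (?R X) = Collect (?R Y)" if "?R X Y" for X Y
    using that sym trans by blast
  have Rep_Abs: "Rep_padic (Padic X :: 'p padic) = Collect (?R X)" if "?R X X" for X
    unfolding Padic_def using that by (subst Abs_padic_inverse) auto
  have rep: "?R (rep_padic x) (rep_padic x) \<and> Padic (rep_padic x) = x" for x :: "'p padic"
  proof -
    obtain X where X: "?R X X" "Rep_padic x = Collect (?R X)" using Rep_padic[of x] by blast
    have XR: "?R X (rep_padic x)"
      unfolding rep_padic_def X(2) mem_Collect_eq by (rule someI[of "?R X"]) (rule X(1))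
    hence "Padic (rep_padic x) = x"
      using Collect_eq[OF XR] X(2) Rep_padic_inverse[of x] by (simp add: Padic_def)
    moreover have "?R (rep_padic x) (rep_padic x)" using trans[OF sym[OF XR] XR] .
    ultimately show ?thesis by blast
  qed
  have rel: "?R X Y \<longleftrightarrow> ?R X X \<and> ?R Y Y \<and> (Padic X :: 'p padic) = Padic Y" for X Y
  proof
    assume XY: "?R X Y"
    have "?R X X" "?R Y Y" using trans[OF XY sym[OF XY]] trans[OF sym[OF XY] XY] .
    thus "?R X X \<and> ?R Y Y \<and> (Padic X :: 'p padic) = Padic Y"
      using Collect_eq[OF XY] by (simp add: Padic_def)
  next
    assume *: "?R X X \<and> ?R Y Y \<and> (Padic X :: 'p padic) = Padic Y"
    hence "Collect (?R X) = Collect (?R Y)" using Rep_Abs by metis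
    with * show "?R X Y" by blast
  qed
  show ?thesis
    unfolding Quotient_def
  proof (intro conjI allI)
    show "Padic (rep_padic x) = x" "?R (rep_padic x) (rep_padic x)" for x :: "'p padic"
      using rep[of x] by blast+
    show "?R X Y \<longleftrightarrow> ?R X X \<and> ?R Y Y \<and> (Padic X :: 'p padic) = Padic Y" for X Y
      by (rule rel)
    show "(cr_padic :: _ \<Rightarrow> 'p padic \<Rightarrow> bool) = (\<lambda>X x. ?R X X \<and> Padic X = x)"
      by (intro ext) (rule cr_padic_def)
  qed
qed

setup_lifting Quotient_padic

instantiation padic :: (prime_card) field
begin

lift_definition zero_padic :: "'a padic" is "\<lambda>n. 0"
  by (simp add: padic_rel_def)

lift_definition one_padic :: "'a padic" is "\<lambda>n. 1"
  by (simp add: padic_rel_def)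

lift_definition plus_padic :: "'a padic \<Rightarrow> 'a padic \<Rightarrow> 'a padic" is "\<lambda>X Y n. X n + Y n"
  unfolding padic_rel_def add_diff_add
  by (simp only: padic_Cauchy_add[OF prime_card] padic_null_add[OF prime_card] simp_thms)

lift_definition uminus_padic :: "'a padic \<Rightarrow> 'a padic" is "\<lambda>X n. - X n"
  unfolding padic_rel_def minus_diff_minus padic_null_uminus
  by (simp only: padic_Cauchy_uminus simp_thms)

lift_definition times_padic :: "'a padic \<Rightarrow> 'a padic \<Rightarrow> 'a padic" is "\<lambda>X Y n. X n * Y n"
proof -
  fix X X' Y Y' :: "nat \<Rightarrow> rat"
  let ?p = "CARD('a)"
  note p = prime_card[where 'a = 'a]
  assume "padic_rel ?p X X'" "padic_rel ?p Y Y'"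
  hence c: "padic_Cauchy ?p X" "padic_Cauchy ?p X'" "padic_Cauchy ?p Y" "padic_Cauchy ?p Y'"
    and n: "padic_null ?p (\<lambda>n. X n - X' n)" "padic_null ?p (\<lambda>n. Y n - Y' n)"
    by (auto simp: padic_rel_def)
  obtain A where A: "\<And>n. rat_padic_abs ?p (Y n) \<le> A"
    using padic_Cauchy_bounded[OF p c(3)] by blast
  obtain B where B: "\<And>n. rat_padic_abs ?p (X' n) \<le> B"
    using padic_Cauchy_bounded[OF p c(2)] by blast
  have "padic_null ?p (\<lambda>n. (X n - X' n) * Y n + (Y n - Y' n) * X' n)"
    by (intro padic_null_add[OF p] padic_null_cmult[OF p n(1) A] padic_null_cmult[OF p n(2) B])
  hence "padic_null ?p (\<lambda>n. X n * Y n - X' n * Y' n)" by (simp add: algebra_simps)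
  thus "padic_rel ?p (\<lambda>n. X n * Y n) (\<lambda>n. X' n * Y' n)"
    using c by (simp add: padic_rel_def padic_Cauchy_mult[OF p])
qed

lift_definition inverse_padic :: "'a padic \<Rightarrow> 'a padic"
  is "\<lambda>X. if padic_null CARD('a) X then (\<lambda>n. 0) else (\<lambda>n. inverse (X n))"
proof -
  fix X Y :: "nat \<Rightarrow> rat"
  note p = prime_card[where 'a = 'a]
  assume "padic_rel CARD('a) X Y"
  thus "?thesis X Y"
    using padic_null_cong[OF p, of X Y]
    by (auto simp: padic_rel_def padic_Cauchy_inverse[OF p] padic_null_inverse_diff[OF p])
qed

definition "x - y = x + - y" for x y :: "'a padic"

definition "x div y = x * inverse y" for x y :: "'a padic"

instance
proof
  note p = prime_card[where 'a = 'a]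
  note rels = padic_rel_def padic_Cauchy_add[OF p] padic_Cauchy_mult[OF p] padic_Cauchy_uminus
  fix a b c :: "'a padic"
  show "a + b = b + a" by transfer (simp add: ac_simps rels)
  show "(a + b) + c = a + (b + c)" by transfer (simp add: ac_simps rels)
  show "0 + a = a" by transfer (simp add: rels)
  show "- a + a = 0" by transfer (simp add: rels)
  show "a - b = a + - b" by (rule minus_padic_def)
  show "(a * b) * c = a * (b * c)" by transfer (simp add: ac_simps rels)
  show "a * b = b * a" by transfer (simp add: ac_simps rels)
  show "1 * a = a" by transfer (simp add: rels)
  show "(a + b) * c = a * c + b * c" by transfer (simp add: distrib_right rels)
  show "(0::'a padic) \<noteq> 1" by transfer (simp add: rels padic_null_def LIMSEQ_const_iff)
  have "padic_null CARD('a) (\<lambda>n. inverse (X n) * X n - 1)"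
    if X: "padic_Cauchy CARD('a) X" "\<not> padic_null CARD('a) X" for X
  proof -
    obtain d N where d: "d > 0" "\<And>n. n \<ge> N \<Longrightarrow> rat_padic_abs CARD('a) (X n) = d"
      using padic_Cauchy_not_null[OF p X] by blast
    have "eventually (\<lambda>n. inverse (X n) * X n - 1 = 0) sequentially"
      using eventually_ge_at_top[of N]
    proof eventually_elim
      case (elim n)
      hence "X n \<noteq> 0" using d(1) d(2)[of n] by auto
      thus ?case by simp
    qed
    from padic_null_eventually[OF this] show ?thesis by simp
  qed
  thus "a \<noteq> 0 \<Longrightarrow> inverse a * a = 1"
    by transfer (auto simp: rels padic_Cauchy_inverse[OF p])
  show "a div b = a * inverse b" by (rule divide_padic_def)
  show "inverse (0::'a padic) = 0" by transfer (simp add: rels)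
qed

end

lift_definition padic_abs :: "'p::prime_card padic \<Rightarrow> real"
  is "\<lambda>X. lim (\<lambda>n. rat_padic_abs CARD('p) (X n))"
  by (rule padic_rel_abs[OF prime_card])

lemma padic_abs_tendsto:
  assumes "padic_Cauchy CARD('p::prime_card) X"
  shows "(\<lambda>n. rat_padic_abs CARD('p) (X n)) \<longlonglongrightarrow> lim (\<lambda>n. rat_padic_abs CARD('p) (X n))"
  using padic_abs_convergent[OF prime_card assms] by (simp add: convergent_LIMSEQ_iff)

lemma padic_abs_nonneg [simp]: "padic_abs x \<ge> 0"
  by transfer (auto simp: padic_rel_def intro!: LIMSEQ_le_const[OF padic_abs_tendsto])

lemma padic_abs_eq_0_iff [simp]: "padic_abs x = 0 \<longleftrightarrow> x = 0"
proof transfer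
  fix X assume "padic_rel CARD('a) X X"
  hence X: "padic_Cauchy CARD('a) X" by (simp add: padic_rel_def)
  show "lim (\<lambda>n. rat_padic_abs CARD('a) (X n)) = 0 \<longleftrightarrow> padic_rel CARD('a) X (\<lambda>n. 0)"
  proof
    assume "lim (\<lambda>n. rat_padic_abs CARD('a) (X n)) = 0"
    thus "padic_rel CARD('a) X (\<lambda>n. 0)"
      using X padic_abs_tendsto[OF X] by (simp add: padic_rel_def padic_null_def)
  next
    assume "padic_rel CARD('a) X (\<lambda>n. 0)"
    hence "(\<lambda>n. rat_padic_abs CARD('a) (X n)) \<longlonglongrightarrow> 0"
      by (simp add: padic_rel_def padic_null_def)
    thus "lim (\<lambda>n. rat_padic_abs CARD('a) (X n)) = 0" by (rule limI)
  qed
qed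

lemma padic_abs_mult: "padic_abs (x * y) = padic_abs x * padic_abs y"
proof transfer
  fix X Y assume "padic_rel CARD('a) X X" "padic_rel CARD('a) Y Y"
  hence "padic_Cauchy CARD('a) X" "padic_Cauchy CARD('a) Y" by (simp_all add: padic_rel_def)
  from tendsto_mult[OF padic_abs_tendsto[OF this(1)] padic_abs_tendsto[OF this(2)]]
  show "lim (\<lambda>n. rat_padic_abs CARD('a) (X n * Y n)) =
        lim (\<lambda>n. rat_padic_abs CARD('a) (X n)) * lim (\<lambda>n. rat_padic_abs CARD('a) (Y n))"
    unfolding rat_padic_abs_mult[OF prime_card] by (rule limI)
qed

lemma padic_abs_ultra: "padic_abs (x + y) \<le> max (padic_abs x) (padic_abs y)"
proof transfer
  fix X Y assume "padic_rel CARD('a) X X" "padic_rel CARD('a) Y Y"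
  hence X: "padic_Cauchy CARD('a) X" and Y: "padic_Cauchy CARD('a) Y"
    by (simp_all add: padic_rel_def)
  show "lim (\<lambda>n. rat_padic_abs CARD('a) (X n + Y n)) \<le>
        max (lim (\<lambda>n. rat_padic_abs CARD('a) (X n))) (lim (\<lambda>n. rat_padic_abs CARD('a) (Y n)))"
    by (rule LIMSEQ_le[OF padic_abs_tendsto[OF padic_Cauchy_add[OF prime_card X Y]]
          tendsto_max[OF padic_abs_tendsto[OF X] padic_abs_tendsto[OF Y]]])
       (auto simp: rat_padic_abs_ultra[OF prime_card])
qed

lemma padic_of_nat_transfer [transfer_rule]:
  "rel_fun (=) (pcr_padic :: _ \<Rightarrow> 'p::prime_card padic \<Rightarrow> bool) (\<lambda>m n. of_nat m) of_nat"
proof -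
  have "pcr_padic (\<lambda>n. of_nat m) (of_nat m :: 'p padic)" for m
  proof (induction m)
    case 0
    show ?case using zero_padic.transfer by simp
  next
    case (Suc m)
    have "pcr_padic (\<lambda>n. 1 + of_nat m) (1 + of_nat m :: 'p padic)"
      using Suc one_padic.transfer[where 'a = 'p] plus_padic.transfer[where 'a = 'p]
      by (auto simp: rel_fun_def)
    thus ?case by simp
  qed
  thus ?thesis by (auto simp: rel_fun_def)
qed

lemma padic_abs_prime: "padic_abs (of_nat CARD('p) :: 'p::prime_card padic) = 1 / real CARD('p)"
  by transfer (simp add: rat_padic_abs_prime[OF prime_card])


section \<open>The dynamical system\<close>

datatype 'a with_infty = Fin 'a | Infty

definition g_map :: "'p::prime_card padic \<Rightarrow> 'p padic \<Rightarrow> 'p padic with_infty \<Rightarrow> 'p padic with_infty"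
  where
  "g_map a b z = (case z of
     Fin u \<Rightarrow> if u\<^sup>2 = - b\<^sup>2 then Infty else Fin (a * ((b\<^sup>2 * u\<^sup>2 + 1) / (b\<^sup>2 + u\<^sup>2)))
   | Infty \<Rightarrow> Fin (a * b\<^sup>2))"

definition E_set :: "'p::prime_card padic set" where
  "E_set = {x. padic_abs (x - 1) < 1}"

definition unit_sphere :: "'p::prime_card padic \<Rightarrow> 'p padic set" where
  "unit_sphere x0 = {x. padic_abs (x - x0) = 1}"

definition basin :: "'p::prime_card padic \<Rightarrow> 'p padic \<Rightarrow> 'p padic \<Rightarrow> 'p padic set" where
  "basin a b x0 = {x. \<exists>N. \<exists>y :: nat \<Rightarrow> 'p padic.
     (\<forall>n\<ge>N. (g_map a b ^^ n) (Fin x) = Fin (y n)) \<and>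
     (\<lambda>n. padic_abs (y n - x0)) \<longlonglongrightarrow> 0}"

definition K_set :: "'p::prime_card padic \<Rightarrow> 'p padic \<Rightarrow> 'p padic set" where
  "K_set b x0 = {x \<in> unit_sphere x0. padic_abs (x\<^sup>2 + 1) \<le> padic_abs (b\<^sup>2 - 1)}"

definition R_set :: "'p::prime_card padic \<Rightarrow> 'p padic \<Rightarrow> 'p padic \<Rightarrow> 'p padic set" where
  "R_set a b x0 = {x. \<forall>n. (g_map a b ^^ n) (Fin x) \<in> Fin ` K_set b x0}"

end

theory Submission
  imports Defs "HOL-Number_Theory.Euler_Criterion"
begin

text \<open>
  Write \<open>\<delta> = \<bar>b\<^sup>2 - 1\<bar>\<close>; since \<open>b \<noteq> 1\<close> and \<open>b + 1\<close> is a unit, \<open>0 < \<delta> < 1\<close>.  Everything rests on two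
  identities,
  \<open>g(u) - a = a (b\<^sup>2 - 1) (u\<^sup>2 - 1) / (b\<^sup>2 + u\<^sup>2)\<close> and
  \<open>g(u) - g(w) = a (b\<^sup>4 - 1) (u - w) (u + w) / ((b\<^sup>2 + u\<^sup>2) (b\<^sup>2 + w\<^sup>2))\<close>.

  By the first, a point with \<open>\<bar>u\<^sup>2 + 1\<bar> > \<delta>\<close> is thrown into the disc \<open>E\<close> around 1 in one step, because then
  \<open>\<bar>b\<^sup>2 + u\<^sup>2\<bar> = \<bar>u\<^sup>2 + 1\<bar>\<close> (\<open>g_enters_E\<close>); \<open>\<infinity>\<close> is thrown there as well.  By the second, \<open>g\<close> contracts
  \<open>E\<close> by the factor \<open>\<delta>\<close> (\<open>g_contracts_E\<close>).  Points with \<open>\<bar>u\<^sup>2 + 1\<bar> < 1\<close> have distance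
  1 from \<open>x\<^sub>0\<close>, so \<open>K\<close> is exactly the set left out, \<open>\<bar>u\<^sup>2 + 1\<bar> \<le> \<delta>\<close> (\<open>K_set_eq\<close>).  Hence an orbit that
  ever leaves \<open>K\<close> converges to \<open>x\<^sub>0\<close>, and one that never does keeps distance 1 from it
  (\<open>basin_eq\<close>).

  The fixed points of \<open>g\<close> are the roots of the cubic
  \<open>x\<^sup>3 - a b\<^sup>2 x\<^sup>2 + b\<^sup>2 x - a = (x - a) (x\<^sup>2 + 1) + (b\<^sup>2 - 1) x (1 - a x)\<close>, a perturbation of
  \<open>(x - 1) (x\<^sup>2 + 1)\<close>, whose roots modulo \<open>p\<close> are simple.  Hensel's lemma lifts the root 1 to the unique
  fixed point in \<open>E\<close>.  If \<open>p \<equiv> 1\<close> modulo 4, it also lifts a square root of \<open>-1\<close>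
  to a fixed point that lies in \<open>K\<close> by the displayed form of the cubic, so \<open>R\<close> is nonempty
  (\<open>fixed_point_in_K\<close>).  Conversely any point of \<open>K\<close> reduces to a square root of \<open>-1\<close>
  modulo \<open>p\<close>, which forces \<open>p \<equiv> 1\<close> modulo 4 by Euler's criterion.

  Hensel's lemma is proved by Newton's iteration from the completeness of the \<open>p\<close>-adic numbers, which in
  turn comes from the construction by Cauchy sequences: rationals are dense, and a Cauchy sequence
  of rationals converges to its own class.
\<close>

section \<open>Ultrametric arithmetic\<close>

lemma padic_abs_1 [simp]: "padic_abs (1 :: 'p::prime_card padic) = 1"
proof -
  have "padic_abs (1 :: 'p padic) * padic_abs (1 :: 'p padic) = padic_abs (1 :: 'p padic)"
    by (simp flip: padic_abs_mult)
  thus ?thesis by simp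
qed

lemma padic_abs_0 [simp]: "padic_abs 0 = 0"
  by (subst padic_abs_eq_0_iff) (rule refl)

lemma padic_abs_power: "padic_abs (x ^ n) = padic_abs x ^ n"
  by (induction n) (auto simp: padic_abs_mult)

lemma padic_abs_uminus [simp]: "padic_abs (- x) = padic_abs x"
proof -
  have "(padic_abs (- x))\<^sup>2 = (padic_abs x)\<^sup>2"
    by (simp flip: padic_abs_power)
  thus ?thesis by (simp add: power2_eq_iff_nonneg)
qed

lemma padic_abs_commute: "padic_abs (x - y) = padic_abs (y - x)"
  by (metis minus_diff_eq padic_abs_uminus)

lemma padic_abs_divide: "padic_abs (x / y) = padic_abs x / padic_abs y"
proof (cases "y = 0")
  case False
  hence "padic_abs (x / y) * padic_abs y = padic_abs x"
    by (simp flip: padic_abs_mult)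
  thus ?thesis using False by (simp add: field_simps)
qed simp

lemma padic_abs_add_le:
  "padic_abs x \<le> c \<Longrightarrow> padic_abs y \<le> c \<Longrightarrow> padic_abs (x + y) \<le> c"
  using padic_abs_ultra[of x y] by linarith

lemma padic_abs_add_less:
  "padic_abs x < c \<Longrightarrow> padic_abs y < c \<Longrightarrow> padic_abs (x + y) < c"
  using padic_abs_ultra[of x y] by linarith

lemma padic_abs_diff_le:
  "padic_abs x \<le> c \<Longrightarrow> padic_abs y \<le> c \<Longrightarrow> padic_abs (x - y) \<le> c"
  using padic_abs_add_le[of x c "- y"] by simp

lemma padic_abs_diff_less:
  "padic_abs x < c \<Longrightarrow> padic_abs y < c \<Longrightarrow> padic_abs (x - y) < c"
  using padic_abs_add_less[of x c "- y"] by simp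

lemma padic_abs_mult_le_1:
  "padic_abs x \<le> 1 \<Longrightarrow> padic_abs y \<le> 1 \<Longrightarrow> padic_abs (x * y) \<le> 1"
  by (simp add: padic_abs_mult mult_le_one)

lemma padic_abs_mult_less_1:
  "padic_abs x \<le> 1 \<Longrightarrow> padic_abs y < 1 \<Longrightarrow> padic_abs (x * y) < 1"
  using mult_left_le_one_le[of "padic_abs y" "padic_abs x"] by (simp add: padic_abs_mult)

text \<open>The isosceles triangle principle: in an ultrametric sum the dominant term decides.\<close>

lemma padic_abs_add_dominant:
  assumes "padic_abs y < padic_abs x"
  shows "padic_abs (x + y) = padic_abs x"
proof -
  have "padic_abs x \<le> max (padic_abs (x + y)) (padic_abs y)"
    using padic_abs_ultra[of "x + y" "- y"] by simp
  thus ?thesis using padic_abs_ultra[of x y] assms by linarith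
qed

lemma padic_abs_of_nat_le_1: "padic_abs (of_nat n) \<le> 1"
  by (induction n) (auto intro: padic_abs_add_le)

lemma padic_abs_2:
  assumes "CARD('p::prime_card) \<ge> 3"
  shows "padic_abs (2 :: 'p padic) = 1"
proof (rule antisym)
  show "padic_abs (2 :: 'p padic) \<le> 1" using padic_abs_of_nat_le_1[of 2] by simp
  show "padic_abs (2 :: 'p padic) \<ge> 1"
  proof (rule ccontr)
    assume small: "\<not> ?thesis"
    obtain k where k: "CARD('p) = 2 * k + 1"
      using prime_odd_nat[OF prime_card[where 'a = 'p]] assms by (auto elim: oddE)
    have "padic_abs (of_nat k * 2 :: 'p padic) < 1"
      using small by (intro padic_abs_mult_less_1 padic_abs_of_nat_le_1) simp
    moreover have "padic_abs (of_nat CARD('p) :: 'p padic) < 1"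
      using assms by (simp add: padic_abs_prime)
    ultimately have "padic_abs (of_nat CARD('p) - of_nat k * 2 :: 'p padic) < 1"
      by (intro padic_abs_diff_less)
    thus False by (simp add: k)
  qed
qed


section \<open>Completeness\<close>

lift_definition padic_of_rat :: "rat \<Rightarrow> 'p::prime_card padic" is "\<lambda>q n. q"
  by (simp add: padic_rel_def)

lemma padic_of_rat_1: "padic_of_rat 1 = 1"
  by transfer (simp add: padic_rel_def)

lemma padic_of_rat_add: "padic_of_rat (q + r) = padic_of_rat q + padic_of_rat r"
  by transfer (simp add: padic_rel_def)

lemma padic_of_rat_mult: "padic_of_rat (q * r) = padic_of_rat q * padic_of_rat r"
  by transfer (simp add: padic_rel_def)

lemma padic_of_rat_diff: "padic_of_rat (q - r) = padic_of_rat q - padic_of_rat r"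
  by (metis add_diff_cancel_right' diff_add_cancel padic_of_rat_add)

lemma padic_abs_of_rat:
  "padic_abs (padic_of_rat q :: 'p::prime_card padic) = rat_padic_abs CARD('p) q"
  by transfer simp

lemma padic_exhaust:
  obtains X where "padic_Cauchy CARD('p) X" "x = (Padic X :: 'p::prime_card padic)"
  using Quotient_abs_rep[OF Quotient_padic, of x] Quotient_rep_reflp[OF Quotient_padic, of x]
  by (metis padic_rel_def)

text \<open>The distance from a class to a rational can be read off along any representing sequence.\<close>

lemma padic_abs_diff_of_rat:
  assumes X: "padic_Cauchy CARD('p::prime_card) X"
  shows "padic_abs (Padic X - padic_of_rat q :: 'p padic) =
    lim (\<lambda>n. rat_padic_abs CARD('p) (X n - q))"
proof -
  have "pcr_padic X (Padic X :: 'p padic)"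
    using X by (simp add: padic.pcr_cr_eq cr_padic_def padic_rel_def)
  hence "pcr_padic (\<lambda>n. X n + - q) (Padic X + - padic_of_rat q :: 'p padic)"
    using plus_padic.transfer[where 'a = 'p] uminus_padic.transfer[where 'a = 'p]
      padic_of_rat.transfer[where 'p = 'p]
    by (fastforce simp: rel_fun_def simp del: add_uminus_conv_diff)
  thus ?thesis
    using padic_abs.transfer[where 'p = 'p] by (auto simp: rel_fun_def)
qed

lemma padic_of_rat_tendsto_Padic:
  assumes X: "padic_Cauchy CARD('p::prime_card) X"
  shows "(\<lambda>n. padic_abs (Padic X - padic_of_rat (X n) :: 'p padic)) \<longlonglongrightarrow> 0"
proof (rule LIMSEQ_I)
  fix e :: real assume e: "e > 0"
  obtain N where N: "\<And>m n. m \<ge> N \<Longrightarrow> n \<ge> N \<Longrightarrow> rat_padic_abs CARD('p) (X m - X n) < e / 2"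
    using padic_CauchyE[OF X, of "e / 2"] e by (meson half_gt_zero)
  have "padic_abs (Padic X - padic_of_rat (X m) :: 'p padic) \<le> e / 2" if "m \<ge> N" for m
    unfolding padic_abs_diff_of_rat[OF X]
  proof (rule LIMSEQ_le_const2[OF padic_abs_tendsto])
    show "padic_Cauchy CARD('p) (\<lambda>n. X n - X m)"
      using padic_Cauchy_add[OF prime_card X padic_Cauchy_const[of _ "- X m"]] by simp
    show "\<exists>N. \<forall>n\<ge>N. rat_padic_abs CARD('p) (X n - X m) \<le> e / 2"
      using N that by (intro exI[of _ N]) (auto intro: less_imp_le)
  qed
  with e show "\<exists>N. \<forall>m\<ge>N. norm (padic_abs (Padic X - padic_of_rat (X m) :: 'p padic) - 0) < e"
    by (intro exI[of _ N]) fastforce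
qed

lemma padic_of_rat_dense:
  assumes "e > 0"
  shows "\<exists>q. padic_abs (x - padic_of_rat q) < e"
proof -
  obtain X where X: "padic_Cauchy CARD('a) X" "x = Padic X" by (rule padic_exhaust)
  from order_tendstoD(2)[OF padic_of_rat_tendsto_Padic[OF X(1)] assms]
  show ?thesis by (auto simp: X(2) eventually_sequentially)
qed

text \<open>
  In an ultrametric space steps tending to 0 already make a sequence Cauchy. To find the limit, the
  sequence is shadowed by rationals \<open>q n\<close>, whose class is then the limit.
\<close>

lemma padic_complete:
  fixes X :: "nat \<Rightarrow> 'p::prime_card padic"
  assumes X: "(\<lambda>n. padic_abs (X (Suc n) - X n)) \<longlonglongrightarrow> 0"
  shows "\<exists>x. (\<lambda>n. padic_abs (X n - x)) \<longlonglongrightarrow> 0"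
proof -
  have "\<exists>q. padic_abs (X n - padic_of_rat q) < 1 / real (Suc n)" for n
    by (rule padic_of_rat_dense) simp
  then obtain q where q: "\<And>n. padic_abs (X n - padic_of_rat (q n)) < 1 / real (Suc n)" by metis
  have qX: "(\<lambda>n. padic_abs (X n - padic_of_rat (q n))) \<longlonglongrightarrow> 0"
  proof (rule tendsto_sandwich[OF _ _ tendsto_const LIMSEQ_inverse_real_of_nat])
    show "eventually (\<lambda>n. padic_abs (X n - padic_of_rat (q n)) \<le> inverse (real (Suc n))) sequentially"
      using q by (intro always_eventually allI less_imp_le) (simp only: inverse_eq_divide)
  qed simp
  have "padic_Cauchy CARD('p) q"
    unfolding padic_Cauchy_def
  proof safe
    fix e :: real assume e: "e > 0"
    have "eventually (\<lambda>n. padic_abs (X (Suc n) - X n) < e \<and>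
        padic_abs (X n - padic_of_rat (q n)) < e) sequentially"
      using order_tendstoD(2)[OF X e] order_tendstoD(2)[OF qX e] by eventually_elim simp
    then obtain N where N: "\<And>n. n \<ge> N \<Longrightarrow> padic_abs (X (Suc n) - X n) < e"
      "\<And>n. n \<ge> N \<Longrightarrow> padic_abs (X n - padic_of_rat (q n)) < e"
      unfolding eventually_sequentially by blast
    have XN: "padic_abs (X n - X N) < e" if "n \<ge> N" for n
      using that
    proof (induction n rule: dec_induct)
      case (step n)
      show ?case using padic_abs_add_less[OF N(1)[OF step(1)] step(3)] by simp
    qed (use e in simp)
    have qN: "padic_abs (padic_of_rat (q n) - X N) < e" if "n \<ge> N" for n
      using padic_abs_diff_less[OF XN[OF that] N(2)[OF that]] by simp
    have "rat_padic_abs CARD('p) (q m - q n) < e" if "m \<ge> N" "n \<ge> N" for m n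
      using padic_abs_diff_less[OF qN[OF that(1)] qN[OF that(2)]]
      by (simp add: padic_abs_of_rat flip: padic_of_rat_diff)
    thus "\<exists>N. \<forall>m\<ge>N. \<forall>n\<ge>N. rat_padic_abs CARD('p) (q m - q n) < e" by blast
  qed
  then obtain x :: "'p padic" where x: "(\<lambda>n. padic_abs (x - padic_of_rat (q n))) \<longlonglongrightarrow> 0"
    using padic_of_rat_tendsto_Padic by blast
  have "(\<lambda>n. padic_abs (X n - x)) \<longlonglongrightarrow> 0"
  proof (rule tendsto_sandwich[OF _ _ tendsto_const])
    show "(\<lambda>n. max (padic_abs (X n - padic_of_rat (q n))) (padic_abs (x - padic_of_rat (q n)))) \<longlonglongrightarrow> 0"
      using tendsto_max[OF qX x] by simp
    show "eventually (\<lambda>n. padic_abs (X n - x) \<le>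
        max (padic_abs (X n - padic_of_rat (q n))) (padic_abs (x - padic_of_rat (q n)))) sequentially"
      using padic_abs_ultra[of "X n - padic_of_rat (q n)" "padic_of_rat (q n) - x" for n]
      by (intro always_eventually allI) (simp add: padic_abs_commute[of _ x])
  qed auto
  thus ?thesis by blast
qed


section \<open>Hensel's lemma\<close>

lemma padic_poly_integral:
  assumes "\<And>i. padic_abs (coeff f i) \<le> 1" "padic_abs x \<le> 1"
  shows "padic_abs (poly f x) \<le> 1"
  using assms(1)
proof (induction f)
  case (pCons c f)
  have "padic_abs c \<le> 1" using pCons.prems[of 0] by simp
  moreover have "padic_abs (poly f x) \<le> 1"
    using pCons.prems[of "Suc i" for i] by (intro pCons.IH) simp
  ultimately show ?case using assms(2) by (simp add: padic_abs_add_le padic_abs_mult_le_1)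
qed simp

text \<open>
  The second-order Taylor expansion. Its remainder is \<open>h\<^sup>2\<close> times an integer polynomial in \<open>x\<close>, \<open>h\<close>
  and the coefficients of \<open>f\<close>, so \<open>e\<close> is integral although it equals \<open>f'' x / 2\<close> to leading order.
  The bound on the derivative is carried along because the inductive step needs it.
\<close>

lemma padic_poly_taylor:
  assumes "\<And>i. padic_abs (coeff f i) \<le> 1" "padic_abs x \<le> 1" "padic_abs h \<le> 1"
  shows "padic_abs (poly (pderiv f) x) \<le> 1 \<and>
    (\<exists>e. padic_abs e \<le> 1 \<and> poly f (x + h) = poly f x + h * poly (pderiv f) x + h\<^sup>2 * e)"
  using assms(1)
proof (induction f)
  case (pCons c f)
  have f: "padic_abs (coeff f i) \<le> 1" for i using pCons.prems[of "Suc i"] by simp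
  from pCons.IH[OF f] obtain e where e: "padic_abs e \<le> 1"
    "poly f (x + h) = poly f x + h * poly (pderiv f) x + h\<^sup>2 * e"
    and d: "padic_abs (poly (pderiv f) x) \<le> 1" by blast
  have "padic_abs (poly (pderiv (pCons c f)) x) \<le> 1"
    using d padic_poly_integral[OF f assms(2)] assms(2)
    by (simp add: pderiv_pCons padic_abs_add_le padic_abs_mult_le_1)
  moreover have "padic_abs (poly (pderiv f) x + (x + h) * e) \<le> 1"
    using d e(1) assms(2,3) by (intro padic_abs_add_le padic_abs_mult_le_1)
  moreover have "poly (pCons c f) (x + h) = poly (pCons c f) x +
      h * poly (pderiv (pCons c f)) x + h\<^sup>2 * (poly (pderiv f) x + (x + h) * e)"
    by (simp add: pderiv_pCons e(2)) (simp add: algebra_simps power2_eq_square)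
  ultimately show ?case by blast
qed (auto intro: exI[of _ 0])

text \<open>
  Newton's iteration \<open>x \<mapsto> x - f x / f' x\<close> keeps \<open>f' x\<close> a unit and squares the size of \<open>f x\<close>, which
  is also the size of the step; so it converges. Two roots \<open>x\<close> and \<open>x + h\<close> with \<open>h\<close> small are equal
  because the expansion reads \<open>0 = h * (unit + h * e)\<close>.
\<close>

theorem hensel:
  fixes c :: "'p::prime_card padic"
  assumes f: "\<And>i. padic_abs (coeff f i) \<le> 1" and c: "padic_abs c \<le> 1"
    and small: "padic_abs (poly f c) < 1" and simple: "padic_abs (poly (pderiv f) c) = 1"
  shows "\<exists>!x. padic_abs (x - c) < 1 \<and> poly f x = 0"
proof -
  let ?f' = "poly (pderiv f)"
  have f': "padic_abs (coeff (pderiv f) i) \<le> 1" for i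
    unfolding coeff_pderiv by (intro padic_abs_mult_le_1 padic_abs_of_nat_le_1 f)
  \<comment> \<open>Newton's iteration never leaves the disc around \<open>c\<close>, where \<open>f'\<close> is a unit.\<close>
  have near: "padic_abs x \<le> 1 \<and> padic_abs (?f' x) = 1" if "padic_abs (x - c) < 1" for x
  proof -
    have xc: "padic_abs (x - c) \<le> 1" using that by simp
    have "padic_abs (c + (x - c)) \<le> 1" using xc c by (intro padic_abs_add_le)
    moreover obtain e where e: "padic_abs e \<le> 1"
      "?f' (c + (x - c)) = ?f' c + (x - c) * poly (pderiv (pderiv f)) c + (x - c)\<^sup>2 * e"
      and d: "padic_abs (poly (pderiv (pderiv f)) c) \<le> 1"
      using padic_poly_taylor[OF f' c xc] by blast
    have "padic_abs ((x - c) * (poly (pderiv (pderiv f)) c + (x - c) * e)) < 1"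
      using padic_abs_mult_less_1[of "poly (pderiv (pderiv f)) c + (x - c) * e" "x - c"] that
        padic_abs_add_le[OF d padic_abs_mult_le_1[of "x - c" e]] e(1)
      by (simp add: mult.commute)
    hence "padic_abs (?f' c + (x - c) * (poly (pderiv (pderiv f)) c + (x - c) * e)) = 1"
      using padic_abs_add_dominant[of _ "?f' c"] simple by simp
    moreover have "?f' x = ?f' c + (x - c) * (poly (pderiv (pderiv f)) c + (x - c) * e)"
      using e(2) by (simp add: algebra_simps power2_eq_square)
    ultimately show ?thesis by simp
  qed
  define r where "r = padic_abs (poly f c)"
  have r: "0 \<le> r" "r < 1" using small by (simp_all add: r_def)
  define X where "X n = ((\<lambda>x. x - poly f x / ?f' x) ^^ n) c" for n
  have X_0: "X 0 = c" and X_Suc: "X (Suc n) = X n - poly f (X n) / ?f' (X n)" for n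
    by (simp_all add: X_def)
  have X: "padic_abs (X n - c) < 1 \<and> padic_abs (poly f (X n)) \<le> r ^ Suc n" for n
  proof (induction n)
    case 0
    show ?case by (simp add: X_0 r_def)
  next
    case (Suc n)
    define x h where "x = X n" and "h = - (poly f x / ?f' x)"
    have x: "padic_abs (x - c) < 1" "padic_abs (poly f x) \<le> r ^ Suc n"
      using Suc by (simp_all add: x_def)
    note unit = near[OF x(1)]
    have h: "padic_abs h = padic_abs (poly f x)"
      using unit by (simp add: h_def padic_abs_divide)
    have h1: "padic_abs h < 1"
      using x(2) r h power_Suc_less_one[of r n] by (cases "r = 0") auto
    obtain e where e: "padic_abs e \<le> 1" "poly f (x + h) = poly f x + h * ?f' x + h\<^sup>2 * e"
      using padic_poly_taylor[OF f conjunct1[OF unit], of h] h1 by auto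
    have "?f' x \<noteq> 0" using unit by auto
    hence "h * ?f' x = - poly f x" by (simp add: h_def)
    hence "poly f (x + h) = h\<^sup>2 * e" by (simp add: e(2))
    hence "padic_abs (poly f (x + h)) \<le> padic_abs h * padic_abs h"
      using e(1) mult_left_le[of "padic_abs e" "padic_abs h * padic_abs h"]
      by (simp add: padic_abs_mult power2_eq_square)
    also have "\<dots> \<le> r ^ Suc n * r"
    proof (rule mult_mono)
      have "r ^ n \<le> 1" using r by (simp add: power_le_one)
      hence "r ^ Suc n \<le> r" using r(1) by (simp add: mult_left_le)
      thus "padic_abs h \<le> r" using h x(2) by simp
    qed (use h x(2) r in auto)
    finally have "padic_abs (poly f (x + h)) \<le> r ^ Suc (Suc n)" by (simp add: mult.commute)
    moreover have "padic_abs (x + h - c) < 1"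
      using padic_abs_add_less[OF x(1) h1] by (simp add: algebra_simps)
    moreover have "X (Suc n) = x + h" by (simp add: X_Suc x_def h_def)
    ultimately show ?case by simp
  qed
  have r_lim: "(\<lambda>n. r ^ Suc n) \<longlonglongrightarrow> 0"
    using r by (intro LIMSEQ_Suc LIMSEQ_realpow_zero)
  have f_lim: "(\<lambda>n. padic_abs (poly f (X n))) \<longlonglongrightarrow> 0"
    by (rule tendsto_sandwich[OF _ _ tendsto_const r_lim])
       (use X in \<open>auto intro!: always_eventually\<close>)
  have "padic_abs (X (Suc n) - X n) = padic_abs (poly f (X n))" for n
    using near[of "X n"] X[of n] by (simp add: X_Suc padic_abs_divide)
  with f_lim obtain x where x: "(\<lambda>n. padic_abs (X n - x)) \<longlonglongrightarrow> 0"
    using padic_complete[of X] by auto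
  have "\<exists>n. padic_abs (X n - x) < 1"
    using order_tendstoD(2)[OF x, of 1] by (auto simp: eventually_sequentially)
  then obtain n where "padic_abs (X n - x) < 1" ..
  hence xc: "padic_abs (x - c) < 1"
    using padic_abs_diff_less[of "X n - c" 1 "X n - x"] X[of n] by simp
  have "poly f x = 0"
  proof (rule ccontr)
    assume "poly f x \<noteq> 0"
    hence pos: "padic_abs (poly f x) > 0" using padic_abs_nonneg[of "poly f x"] by (simp add: less_le)
    have "eventually (\<lambda>n. padic_abs (X n - x) < min 1 (padic_abs (poly f x)) \<and>
        padic_abs (poly f (X n)) < padic_abs (poly f x)) sequentially"
      using order_tendstoD(2)[OF x, of "min 1 (padic_abs (poly f x))"] order_tendstoD(2)[OF f_lim pos]
        pos by (intro eventually_conj) auto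
    then obtain n where n: "padic_abs (X n - x) < 1" "padic_abs (X n - x) < padic_abs (poly f x)"
      "padic_abs (poly f (X n)) < padic_abs (poly f x)"
      by (auto simp: eventually_sequentially)
    define h where "h = X n - x"
    obtain e where e: "padic_abs e \<le> 1" "poly f (x + h) = poly f x + h * ?f' x + h\<^sup>2 * e"
      using padic_poly_taylor[OF f conjunct1[OF near[OF xc]], of h] n(1) by (auto simp: h_def)
    have "padic_abs (?f' x + h * e) \<le> 1"
      using near[OF xc] n(1) e(1) by (intro padic_abs_add_le padic_abs_mult_le_1) (auto simp: h_def)
    hence "padic_abs (h * (?f' x + h * e)) \<le> padic_abs h"
      by (simp add: padic_abs_mult mult_left_le)
    hence "padic_abs (poly f x + h * (?f' x + h * e)) = padic_abs (poly f x)"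
      using n(2) by (intro padic_abs_add_dominant) (simp add: h_def)
    moreover have "poly f (X n) = poly f x + h * (?f' x + h * e)"
      using e(2) by (simp add: h_def algebra_simps power2_eq_square)
    ultimately show False using n(3) by simp
  qed
  moreover have "y = x" if "padic_abs (y - c) < 1" "poly f y = 0" "poly f x = 0" for y
  proof (rule ccontr)
    assume "y \<noteq> x"
    define h where "h = y - x"
    have h: "padic_abs h < 1"
      using padic_abs_diff_less[OF that(1) xc] by (simp add: h_def)
    obtain e where e: "padic_abs e \<le> 1" "poly f (x + h) = poly f x + h * ?f' x + h\<^sup>2 * e"
      using padic_poly_taylor[OF f conjunct1[OF near[OF xc]], of h] h by auto
    have "h * (?f' x + e * h) = 0"
      using e(2) that(2,3) by (simp add: h_def algebra_simps power2_eq_square)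
    hence "?f' x + e * h = 0" using \<open>y \<noteq> x\<close> by (simp add: h_def)
    moreover have "padic_abs (?f' x + e * h) = padic_abs (?f' x)"
      using padic_abs_mult_less_1[OF e(1) h] near[OF xc] by (intro padic_abs_add_dominant) simp
    ultimately show False using near[OF xc] by simp
  qed
  ultimately show ?thesis using xc by blast
qed


section \<open>Square roots of -1 in the residue field\<close>

lemma QuadRes_minus_one_iff:
  assumes p: "prime p" "p > 2"
  shows "QuadRes (int p) (- 1) \<longleftrightarrow> [p = 1] (mod 4)"
proof -
  have ne: "\<not> [- 1 = (0 :: int)] (mod int p)" "\<not> [1 = (- 1 :: int)] (mod int p)"
    using p(2) zdvd_imp_le[of "int p" 1] zdvd_imp_le[of "int p" 2]
    by (auto simp: cong_iff_dvd_diff)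
  have odd: "odd p" using p prime_odd_nat by blast
  have "[Legendre (- 1) (int p) = (- 1) ^ ((p - 1) div 2)] (mod int p)"
    using euler_criterion[OF p, of "- 1"] by simp
  hence "QuadRes (int p) (- 1) \<longleftrightarrow> even ((p - 1) div 2)"
    using ne cong_sym by (auto simp: Legendre_def uminus_power_if split: if_splits)
  also have "\<dots> \<longleftrightarrow> [p = 1] (mod 4)"
    using odd unfolding cong_def by presburger
  finally show ?thesis .
qed

lemma rat_padic_abs_of_int_less_1:
  assumes "prime p" "rat_padic_abs p (of_int k) < 1"
  shows "int p dvd k"
proof (rule ccontr)
  assume "\<not> int p dvd k"
  moreover from this have "k \<noteq> 0" by auto
  ultimately have "rat_padic_abs p (of_int k / of_int 1) = 1"
    using assms(1) by (subst rat_padic_abs_frac) (auto simp: not_dvd_imp_multiplicity_0)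
  thus False using assms(2) by simp
qed

lemma rat_padic_abs_of_int_le_1:
  assumes "prime p"
  shows "rat_padic_abs p (of_int k) \<le> 1"
proof (cases "k = 0")
  case False
  hence "rat_padic_abs p (of_int k / of_int 1) \<le> 1"
    using assms prime_gt_0_nat[OF assms]
    by (subst rat_padic_abs_frac)
       (auto simp: power_int_minus intro!: inverse_le_1_iff[THEN iffD2] one_le_power)
  thus ?thesis by simp
qed simp

lemma padic_abs_le_1_near_sqrt_minus_one:
  assumes "padic_abs (x\<^sup>2 + 1) < 1"
  shows "padic_abs x \<le> 1"
  using padic_abs_diff_le[of "x\<^sup>2 + 1" 1 1] assms by (simp add: padic_abs_power power_le_one_iff)

text \<open>
  This is the passage to the residue field: a rational \<open>r / s\<close> close enough to \<open>x\<close> satisfies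
  \<open>p dvd r\<^sup>2 + s\<^sup>2\<close>, and \<open>p\<close> cannot divide \<open>s\<close> when the fraction is reduced, so \<open>r / s\<close> makes sense
  modulo \<open>p\<close> and squares to \<open>-1\<close>.
\<close>

lemma QuadRes_minus_one_if_padic:
  fixes x :: "'p::prime_card padic"
  assumes x: "padic_abs (x\<^sup>2 + 1) < 1"
  shows "QuadRes (int CARD('p)) (- 1)"
proof -
  let ?p = "CARD('p)"
  note p = prime_card[where 'a = 'p]
  note x_le = padic_abs_le_1_near_sqrt_minus_one[OF x]
  obtain q where q: "padic_abs (x - padic_of_rat q) < 1"
    using padic_of_rat_dense[of 1 x] by auto
  \<comment> \<open>\<open>x\<^sup>2 - q\<^sup>2 = (x + q) (x - q)\<close>, with \<open>x + q\<close> expressed through \<open>x\<close> and \<open>x - q\<close>, whose sizes are known\<close>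
  have "padic_abs (x + x - (x - padic_of_rat q)) \<le> 1"
    by (rule padic_abs_diff_le[OF padic_abs_add_le[OF x_le x_le] less_imp_le[OF q]])
  hence "padic_abs ((x + x - (x - padic_of_rat q)) * (x - padic_of_rat q)) < 1"
    using q by (rule padic_abs_mult_less_1)
  hence "padic_abs (x\<^sup>2 + 1 - (x + x - (x - padic_of_rat q)) * (x - padic_of_rat q)) < 1"
    using x by (intro padic_abs_diff_less)
  also have "x\<^sup>2 + 1 - (x + x - (x - padic_of_rat q)) * (x - padic_of_rat q) = padic_of_rat (q\<^sup>2 + 1)"
    by (simp add: padic_of_rat_add padic_of_rat_mult padic_of_rat_1 power2_eq_square algebra_simps)
  finally have q1: "rat_padic_abs ?p (q\<^sup>2 + 1) < 1" by (simp add: padic_abs_of_rat)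
  obtain r s where rs: "quotient_of q = (r, s)" by (cases "quotient_of q")
  have s: "s > 0" and qrs: "q = of_int r / of_int s" and cop: "coprime r s"
    using quotient_of_denom_pos[OF rs] quotient_of_div[OF rs] quotient_of_coprime[OF rs] by auto
  have "of_int (r\<^sup>2 + s\<^sup>2) = (q\<^sup>2 + 1) * of_int (s\<^sup>2)"
    using s by (simp add: qrs field_simps)
  hence "rat_padic_abs ?p (of_int (r\<^sup>2 + s\<^sup>2)) =
      rat_padic_abs ?p (q\<^sup>2 + 1) * rat_padic_abs ?p (of_int (s\<^sup>2))"
    by (simp only: rat_padic_abs_mult[OF p])
  also have "\<dots> \<le> rat_padic_abs ?p (q\<^sup>2 + 1)"
    by (intro mult_left_le rat_padic_abs_of_int_le_1[OF p]) simp
  finally have dvd: "int ?p dvd r\<^sup>2 + s\<^sup>2"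
    using q1 by (intro rat_padic_abs_of_int_less_1[OF p]) simp
  have "\<not> int ?p dvd s"
  proof
    assume ps: "int ?p dvd s"
    hence "int ?p dvd r\<^sup>2" using dvd by (simp add: dvd_add_left_iff power2_eq_square)
    hence "int ?p dvd r" using p prime_dvd_power[of "int ?p" r 2] by simp
    hence "int ?p dvd 1" using ps cop by (rule coprime_common_divisor[rotated])
    thus False using prime_gt_1_nat[OF p] by simp
  qed
  hence "coprime s (int ?p)"
    using p prime_imp_coprime[of "int ?p" s] by (simp add: coprime_commute)
  then obtain t where t: "[s * t = 1] (mod int ?p)" using cong_solve_coprime_int by blast
  have "[(r * t)\<^sup>2 + (s * t)\<^sup>2 = 0] (mod int ?p)"
    using dvd dvd_mult2[OF dvd, of "t\<^sup>2"] by (simp add: cong_0_iff power_mult_distrib distrib_right)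
  moreover have "[(r * t)\<^sup>2 + (s * t)\<^sup>2 = (r * t)\<^sup>2 + 1\<^sup>2] (mod int ?p)"
    using t by (intro cong_add cong_pow cong_refl)
  ultimately have "[(r * t)\<^sup>2 + 1 = 0] (mod int ?p)" by (simp add: cong_def)
  hence "[(r * t)\<^sup>2 = - 1] (mod int ?p)" by (simp add: cong_iff_dvd_diff)
  thus ?thesis unfolding QuadRes_def by blast
qed


section \<open>The dynamics of the map\<close>

lemma E_set_abs: "x \<in> E_set \<Longrightarrow> padic_abs x = 1"
  using padic_abs_add_dominant[of "x - 1" 1] by (simp add: E_set_def)

lemma E_set_mult: "x \<in> E_set \<Longrightarrow> y \<in> E_set \<Longrightarrow> x * y \<in> E_set"
  using padic_abs_add_less[of "x * (y - 1)" 1 "x - 1"] padic_abs_mult_less_1[of x "y - 1"] E_set_abs[of x]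
  by (simp add: E_set_def algebra_simps)

lemma E_set_square: "x \<in> E_set \<Longrightarrow> x\<^sup>2 \<in> E_set"
  by (simp add: power2_eq_square E_set_mult)

definition fixpoint_cubic :: "'p::prime_card padic \<Rightarrow> 'p padic \<Rightarrow> 'p padic poly" where
  "fixpoint_cubic a b = [:- a, b\<^sup>2, - (a * b\<^sup>2), 1:]"

text \<open>Written this way, the cubic shows its roots in the limit \<open>b\<^sup>2 = 1\<close>.\<close>

lemma poly_fixpoint_cubic:
  "poly (fixpoint_cubic a b) x = (x - a) * (x\<^sup>2 + 1) + (b\<^sup>2 - 1) * (x * (1 - a * x))"
  by (simp add: fixpoint_cubic_def algebra_simps power2_eq_square)

lemma poly_pderiv_fixpoint_cubic:
  "poly (pderiv (fixpoint_cubic a b)) x = 3 * x\<^sup>2 - 2 * (a * b\<^sup>2 * x) + b\<^sup>2"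
  by (simp add: fixpoint_cubic_def pderiv_pCons algebra_simps power2_eq_square)

locale g_system =
  fixes a b :: "'p::prime_card padic"
  assumes p3: "CARD('p) \<ge> 3" and a: "a \<in> E_set" and b: "b \<in> E_set" and b1: "b \<noteq> 1"
begin

lemmas abs_2 = padic_abs_2[OF p3]
lemmas bb = E_set_square[OF b]

lemma abs_add_E: "x \<in> E_set \<Longrightarrow> y \<in> E_set \<Longrightarrow> padic_abs (x + y :: 'p padic) = 1"
  using padic_abs_add_dominant[of "(x - 1) + (y - 1)" 2] padic_abs_add_less[of "x - 1" 1 "y - 1"] abs_2
  by (simp add: E_set_def)

lemma one_E: "(1 :: 'p padic) \<in> E_set" by (simp add: E_set_def)

lemma delta: "0 < padic_abs (b\<^sup>2 - 1)" "padic_abs (b\<^sup>2 - 1) < 1"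
proof -
  have "b\<^sup>2 - 1 = (b - 1) * (b + 1)" by (simp add: algebra_simps power2_eq_square)
  moreover have "b + 1 \<noteq> 0" using abs_add_E[OF b one_E] by auto
  ultimately have "b\<^sup>2 - 1 \<noteq> 0" using b1 by simp
  thus "0 < padic_abs (b\<^sup>2 - 1)"
    using padic_abs_nonneg[of "b\<^sup>2 - 1"] by (simp add: less_le del: padic_abs_nonneg)
  show "padic_abs (b\<^sup>2 - 1) < 1" using bb by (simp add: E_set_def)
qed

lemma abs_b4: "padic_abs (b\<^sup>2 * b\<^sup>2 - 1) = padic_abs (b\<^sup>2 - 1)"
proof -
  have "b\<^sup>2 * b\<^sup>2 - 1 = (b\<^sup>2 - 1) * (b\<^sup>2 + 1)" by (simp add: algebra_simps)
  thus ?thesis using abs_add_E[OF bb one_E] by (simp add: padic_abs_mult)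
qed

text \<open>
  Clearing denominators introduces no spurious root: at a pole the cubic equals \<open>a (b\<^sup>4 - 1) \<noteq> 0\<close>.
\<close>

lemma g_fixed_iff: "g_map a b (Fin x) = Fin x \<longleftrightarrow> poly (fixpoint_cubic a b) x = 0"
proof -
  have cubic: "poly (fixpoint_cubic a b) x = x * (b\<^sup>2 + x\<^sup>2) - a * (b\<^sup>2 * x\<^sup>2 + 1)"
    by (simp add: fixpoint_cubic_def algebra_simps power2_eq_square)
  show ?thesis
  proof (cases "x\<^sup>2 = - b\<^sup>2")
    case True
    have "poly (fixpoint_cubic a b) x = a * (b\<^sup>2 * b\<^sup>2 - 1)"
      unfolding cubic True by (simp add: algebra_simps)
    moreover have "a \<noteq> 0" "b\<^sup>2 * b\<^sup>2 - 1 \<noteq> 0" using E_set_abs[OF a] delta abs_b4 by force+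
    ultimately show ?thesis using True by (simp add: g_map_def)
  next
    case False
    hence "b\<^sup>2 + x\<^sup>2 \<noteq> 0" by (metis add.inverse_unique)
    thus ?thesis using False by (auto simp: g_map_def cubic field_simps)
  qed
qed

lemma cubic_integral: "padic_abs (coeff (fixpoint_cubic a b) i) \<le> 1"
  using E_set_abs[OF a] E_set_abs[OF bb]
  by (auto simp: fixpoint_cubic_def coeff_pCons padic_abs_mult split: nat.splits)

lemma cubic_small:
  assumes "padic_abs c \<le> 1" "padic_abs ((c - a) * (c\<^sup>2 + 1)) < 1"
  shows "padic_abs (poly (fixpoint_cubic a b) c) < 1"
proof -
  have "padic_abs (c * (1 - a * c)) \<le> 1"
    using assms(1) E_set_abs[OF a] by (intro padic_abs_mult_le_1 padic_abs_diff_le) simp_all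
  from padic_abs_mult_less_1[OF this delta(2)] assms(2) show ?thesis
    by (simp add: poly_fixpoint_cubic padic_abs_add_less mult.commute)
qed

text \<open>Modulo the maximal ideal the derivative is that of \<open>(x - 1) (x\<^sup>2 + 1)\<close>.\<close>

lemma cubic_deriv_unit:
  assumes "padic_abs c \<le> 1" "padic_abs (3 * c\<^sup>2 - 2 * c + 1) = 1"
  shows "padic_abs (poly (pderiv (fixpoint_cubic a b)) c) = 1"
proof -
  have "padic_abs (2 * c * (a * b\<^sup>2 - 1)) < 1"
  proof (rule padic_abs_mult_less_1)
    show "padic_abs (2 * c) \<le> 1" using assms(1) abs_2 by (simp add: padic_abs_mult)
    show "padic_abs (a * b\<^sup>2 - 1) < 1" using E_set_mult[OF a bb] by (simp add: E_set_def)
  qed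
  hence "padic_abs (b\<^sup>2 - 1 - 2 * c * (a * b\<^sup>2 - 1)) < 1"
    by (rule padic_abs_diff_less[OF delta(2)])
  from padic_abs_add_dominant[of _ "3 * c\<^sup>2 - 2 * c + 1", unfolded assms(2), OF this]
  show ?thesis by (simp add: poly_pderiv_fixpoint_cubic algebra_simps)
qed

lemma ex1_fixed_point: "\<exists>!x. x \<in> E_set \<and> g_map a b (Fin x) = Fin x"
proof -
  have "padic_abs (1 - a) < 1" using a by (simp add: E_set_def padic_abs_commute)
  hence "padic_abs ((1 - a) * (1\<^sup>2 + 1)) < 1" unfolding padic_abs_mult using abs_2 by simp
  hence "\<exists>!x. padic_abs (x - 1) < 1 \<and> poly (fixpoint_cubic a b) x = 0"
    using abs_2 by (intro hensel cubic_integral cubic_small cubic_deriv_unit) simp_all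
  thus ?thesis by (simp add: E_set_def g_fixed_iff)
qed

text \<open>
  With \<open>\<delta> = \<bar>b\<^sup>2 - 1\<bar>\<close> one has \<open>\<bar>g(x) - a\<bar> = \<delta> \<bar>x\<^sup>2 - 1\<bar> / \<bar>x\<^sup>2 + 1\<bar>\<close> with \<open>\<bar>x\<^sup>2 - 1\<bar> \<le> max \<bar>x\<^sup>2 + 1\<bar> 1\<close>.
  If the maximum is 1, the quotient is below 1 by hypothesis; otherwise it is at most \<open>\<delta>\<close>.
\<close>

lemma g_enters_E:
  assumes x: "padic_abs (x\<^sup>2 + 1) > padic_abs (b\<^sup>2 - 1)"
  shows "\<exists>y\<in>E_set. g_map a b (Fin x) = Fin y"
proof -
  have den: "padic_abs (b\<^sup>2 + x\<^sup>2) = padic_abs (x\<^sup>2 + 1)"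
    using padic_abs_add_dominant[OF x] by (simp add: add.commute)
  have nz: "b\<^sup>2 + x\<^sup>2 \<noteq> 0" using den x delta(1) by auto
  define y where "y = a * ((b\<^sup>2 * x\<^sup>2 + 1) / (b\<^sup>2 + x\<^sup>2))"
  have "y - a = a * ((b\<^sup>2 - 1) * (x\<^sup>2 - 1)) / (b\<^sup>2 + x\<^sup>2)"
    using nz by (simp add: y_def field_simps)
  hence "padic_abs (y - a) = padic_abs (b\<^sup>2 - 1) * padic_abs (x\<^sup>2 - 1) / padic_abs (x\<^sup>2 + 1)"
    using den E_set_abs[OF a] by (simp add: padic_abs_divide padic_abs_mult)
  moreover have "padic_abs (b\<^sup>2 - 1) * padic_abs (x\<^sup>2 - 1) < padic_abs (x\<^sup>2 + 1)"
  proof -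
    have "padic_abs (x\<^sup>2 - 1) \<le> max (padic_abs (x\<^sup>2 + 1)) 1"
      using padic_abs_ultra[of "x\<^sup>2 + 1" "- 2"] abs_2 by simp
    hence "padic_abs (b\<^sup>2 - 1) * padic_abs (x\<^sup>2 - 1) \<le> padic_abs (b\<^sup>2 - 1) * max (padic_abs (x\<^sup>2 + 1)) 1"
      by (intro mult_left_mono) simp_all
    also have "\<dots> < padic_abs (x\<^sup>2 + 1)"
      using x delta by (auto simp: max_def)
    finally show ?thesis .
  qed
  ultimately have "padic_abs (y - a) < 1" using x delta(1) by (simp add: divide_less_eq_1)
  hence "y \<in> E_set" using padic_abs_add_less[of "y - a" 1 "a - 1"] a by (simp add: E_set_def)
  moreover have "g_map a b (Fin x) = Fin y"
    using nz by (auto simp: g_map_def y_def)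
  ultimately show ?thesis by blast
qed

lemma E_square_plus_1:
  assumes "x \<in> E_set"
  shows "padic_abs (x\<^sup>2 + 1 :: 'p padic) = 1"
  using abs_add_E[OF E_set_square[OF assms] one_E] .

text \<open>Square roots of \<open>-1\<close> and of \<open>1\<close> lie in different residue classes since \<open>2\<close> is a unit.\<close>

lemma abs_diff_E:
  assumes x: "padic_abs (x\<^sup>2 + 1) < 1" and y: "y \<in> E_set"
  shows "padic_abs (x - y :: 'p padic) = 1"
proof -
  have "padic_abs (- (y\<^sup>2 + 1) + (x\<^sup>2 + 1)) = padic_abs (- (y\<^sup>2 + 1))"
    by (rule padic_abs_add_dominant, subst padic_abs_uminus) (use x E_square_plus_1[OF y] in simp)
  also have "\<dots> = 1"
    by (subst padic_abs_uminus) (rule E_square_plus_1[OF y])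
  finally have *: "padic_abs (x - y) * padic_abs (x + y) = 1"
    by (simp add: algebra_simps power2_eq_square flip: padic_abs_mult)
  have "padic_abs (x - y) \<le> 1" "padic_abs (x + y) \<le> 1"
    using padic_abs_le_1_near_sqrt_minus_one[OF x] E_set_abs[OF y]
    by (simp_all add: padic_abs_diff_le padic_abs_add_le)
  thus ?thesis using * mult_left_le[of "padic_abs (x + y)" "padic_abs (x - y)"] by simp
qed

lemma g_E:
  assumes x: "x \<in> E_set"
  shows "a * ((b\<^sup>2 * x\<^sup>2 + 1) / (b\<^sup>2 + x\<^sup>2)) \<in> E_set"
    "g_map a b (Fin x) = Fin (a * ((b\<^sup>2 * x\<^sup>2 + 1) / (b\<^sup>2 + x\<^sup>2)))"
proof -
  have "b\<^sup>2 + x\<^sup>2 \<noteq> 0" using abs_add_E[OF bb E_set_square[OF x]] by auto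
  thus *: "g_map a b (Fin x) = Fin (a * ((b\<^sup>2 * x\<^sup>2 + 1) / (b\<^sup>2 + x\<^sup>2)))"
    by (auto simp: g_map_def)
  have "\<exists>y\<in>E_set. g_map a b (Fin x) = Fin y"
    using E_square_plus_1[OF x] delta by (intro g_enters_E) simp
  thus "a * ((b\<^sup>2 * x\<^sup>2 + 1) / (b\<^sup>2 + x\<^sup>2)) \<in> E_set" by (auto simp: *)
qed

lemma g_contracts_E:
  assumes x: "x \<in> E_set" "g_map a b (Fin x) = Fin y" and w: "w \<in> E_set" "g_map a b (Fin w) = Fin z"
  shows "padic_abs (y - z) \<le> padic_abs (b\<^sup>2 - 1) * padic_abs (x - w)"
proof -
  have den: "padic_abs (b\<^sup>2 + x\<^sup>2) = 1" "padic_abs (b\<^sup>2 + w\<^sup>2) = 1"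
    using abs_add_E[OF bb E_set_square] x(1) w(1) by auto
  hence nz: "b\<^sup>2 + x\<^sup>2 \<noteq> 0" "b\<^sup>2 + w\<^sup>2 \<noteq> 0" by auto
  have "y - z = a * ((b\<^sup>2 * x\<^sup>2 + 1) / (b\<^sup>2 + x\<^sup>2)) - a * ((b\<^sup>2 * w\<^sup>2 + 1) / (b\<^sup>2 + w\<^sup>2))"
    using g_E(2)[OF x(1)] g_E(2)[OF w(1)] x(2) w(2) by simp
  also have "\<dots> = a * (((b\<^sup>2 * x\<^sup>2 + 1) * (b\<^sup>2 + w\<^sup>2) - (b\<^sup>2 * w\<^sup>2 + 1) * (b\<^sup>2 + x\<^sup>2))
      / ((b\<^sup>2 + x\<^sup>2) * (b\<^sup>2 + w\<^sup>2)))"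
    by (simp only: diff_frac_eq[OF nz] flip: right_diff_distrib)
  also have "(b\<^sup>2 * x\<^sup>2 + 1) * (b\<^sup>2 + w\<^sup>2) - (b\<^sup>2 * w\<^sup>2 + 1) * (b\<^sup>2 + x\<^sup>2) =
      (b\<^sup>2 * b\<^sup>2 - 1) * ((x - w) * (x + w))"
    by (simp add: algebra_simps power2_eq_square)
  finally have "padic_abs (y - z) = padic_abs (b\<^sup>2 - 1) * padic_abs (x - w) * padic_abs (x + w)"
    using den E_set_abs[OF a] abs_b4 by (simp add: padic_abs_divide padic_abs_mult)
  thus ?thesis using abs_add_E[OF x(1) w(1)] by simp
qed

end

locale g_system_fixed = g_system a b for a b :: "'p::prime_card padic" +
  fixes x0 :: "'p padic"
  assumes x0: "x0 \<in> E_set" "g_map a b (Fin x0) = Fin x0"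
begin

text \<open>
  This form exhibits \<open>K\<close> as the complement of what \<open>g_enters_E\<close> covers. It holds because a point near
  a square root of \<open>-1\<close> has distance 1 from every point of \<open>E\<close>.
\<close>

lemma K_set_eq: "K_set b x0 = {x. padic_abs (x\<^sup>2 + 1) \<le> padic_abs (b\<^sup>2 - 1)}"
proof -
  have "padic_abs (x - x0) = 1" if "padic_abs (x\<^sup>2 + 1) \<le> padic_abs (b\<^sup>2 - 1)" for x
    using abs_diff_E[OF _ x0(1)] that delta(2) by simp
  thus ?thesis by (auto simp: K_set_def unit_sphere_def)
qed

lemma E_subset_basin: "E_set \<subseteq> basin a b x0"
proof
  fix x :: "'p padic"
  assume x: "x \<in> E_set"
  let ?d = "padic_abs (b\<^sup>2 - 1)"
  have "\<exists>z\<in>E_set. (g_map a b ^^ n) (Fin x) = Fin z \<and> padic_abs (z - x0) \<le> ?d ^ n" for n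
  proof (induction n)
    case 0
    show ?case using x padic_abs_diff_less[of "x - 1" 1 "x0 - 1"] x0(1) by (auto simp: E_set_def)
  next
    case (Suc n)
    then obtain z where z: "z \<in> E_set" "(g_map a b ^^ n) (Fin x) = Fin z"
      "padic_abs (z - x0) \<le> ?d ^ n"
      by blast
    have "padic_abs (a * ((b\<^sup>2 * z\<^sup>2 + 1) / (b\<^sup>2 + z\<^sup>2)) - x0) \<le> ?d * padic_abs (z - x0)"
      by (rule g_contracts_E[OF z(1) g_E(2)[OF z(1)] x0])
    also have "\<dots> \<le> ?d * ?d ^ n" using z(3) by (intro mult_left_mono) simp_all
    finally show ?case using g_E[OF z(1)] z(2) by auto
  qed
  then obtain y where y: "\<And>n. (g_map a b ^^ n) (Fin x) = Fin (y n)"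
    "\<And>n. padic_abs (y n - x0) \<le> ?d ^ n"
    by metis
  have d_lim: "(\<lambda>n. ?d ^ n) \<longlonglongrightarrow> 0"
    using delta by (intro LIMSEQ_realpow_zero) simp_all
  have "(\<lambda>n. padic_abs (y n - x0)) \<longlonglongrightarrow> 0"
    by (rule tendsto_sandwich[OF _ _ tendsto_const d_lim]) (simp_all add: y(2))
  thus "x \<in> basin a b x0" using y(1) by (auto simp: basin_def)
qed

lemma basin_backward:
  assumes "(g_map a b ^^ m) (Fin x) = Fin y" "y \<in> basin a b x0"
  shows "x \<in> basin a b x0"
proof -
  from assms(2) obtain N z where z: "\<And>n. n \<ge> N \<Longrightarrow> (g_map a b ^^ n) (Fin y) = Fin (z n)"
    "(\<lambda>n. padic_abs (z n - x0)) \<longlonglongrightarrow> 0" by (auto simp: basin_def)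
  have "(g_map a b ^^ n) (Fin x) = Fin (z (n - m))" if "n \<ge> N + m" for n
  proof -
    have "(g_map a b ^^ (n - m + m)) (Fin x) = Fin (z (n - m))"
      using z(1)[of "n - m"] that assms(1) by (subst funpow_add) simp
    thus ?thesis using that by simp
  qed
  moreover have "(\<lambda>n. padic_abs (z (n - m) - x0)) \<longlonglongrightarrow> 0"
    by (rule LIMSEQ_offset[of _ m]) (use z(2) in simp)
  ultimately show ?thesis
    unfolding basin_def by (intro CollectI exI[of _ "N + m"] exI[of _ "\<lambda>n. z (n - m)"]) auto
qed

lemma g_outside_K_in_E:
  assumes "z \<notin> Fin ` K_set b x0"
  shows "\<exists>y\<in>E_set. g_map a b z = Fin y"
proof (cases z)
  case (Fin x)
  thus ?thesis using assms by (auto simp: K_set_eq intro!: g_enters_E)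
next
  case Infty
  thus ?thesis using E_set_mult[OF a bb] by (auto simp: g_map_def)
qed

theorem basin_eq: "basin a b x0 = UNIV - R_set a b x0"
proof (intro equalityI subsetI)
  fix x assume "x \<in> basin a b x0"
  then obtain N y where y: "\<And>n. n \<ge> N \<Longrightarrow> (g_map a b ^^ n) (Fin x) = Fin (y n)"
    "(\<lambda>n. padic_abs (y n - x0)) \<longlonglongrightarrow> 0" by (auto simp: basin_def)
  from order_tendstoD(2)[OF y(2), of 1] obtain M where
    M: "\<And>n. n \<ge> M \<Longrightarrow> padic_abs (y n - x0) < 1" by (auto simp: eventually_sequentially)
  let ?n = "max M N"
  have "y ?n \<notin> K_set b x0" using M[of ?n] by (simp add: K_set_def unit_sphere_def)
  hence "(g_map a b ^^ ?n) (Fin x) \<notin> Fin ` K_set b x0" using y(1)[of ?n] by auto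
  thus "x \<in> UNIV - R_set a b x0" by (auto simp: R_set_def)
next
  fix x assume "x \<in> UNIV - R_set a b x0"
  then obtain n where "(g_map a b ^^ n) (Fin x) \<notin> Fin ` K_set b x0" by (auto simp: R_set_def)
  from g_outside_K_in_E[OF this] obtain y where
    "y \<in> E_set" "(g_map a b ^^ Suc n) (Fin x) = Fin y" by auto
  thus "x \<in> basin a b x0" using basin_backward E_subset_basin by blast
qed

text \<open>
  Hensel's lemma lifts an integer \<open>c\<close> with \<open>p dvd c\<^sup>2 + 1\<close> to a root \<open>x\<close> of the cubic; the
  derivative there is \<open>-2 (1 + c)\<close> modulo \<open>p\<close>, a unit. Such a root satisfies
  \<open>(x - a) (x\<^sup>2 + 1) = - (b\<^sup>2 - 1) x (1 - a x)\<close> with \<open>x - a\<close> a unit, hence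
  \<open>\<bar>x\<^sup>2 + 1\<bar> \<le> \<bar>b\<^sup>2 - 1\<bar>\<close>.
\<close>

lemma fixed_point_in_K:
  assumes "QuadRes (int CARD('p)) (- 1)"
  shows "\<exists>x\<in>K_set b x0. g_map a b (Fin x) = Fin x"
proof -
  let ?p = "CARD('p)"
  note p = prime_card[where 'a = 'p]
  from assms obtain n where n: "[n\<^sup>2 = - 1] (mod int ?p)" by (auto simp: QuadRes_def)
  define m where "m = nat (n mod int ?p)"
  have m: "int m = n mod int ?p" using prime_gt_0_nat[OF p] by (simp add: m_def)
  have "[int m = n] (mod int ?p)" by (simp add: cong_def m)
  hence "[(int m)\<^sup>2 = - 1] (mod int ?p)" using n cong_pow cong_trans by blast
  hence "int ?p dvd int (m\<^sup>2 + 1)" by (simp add: cong_iff_dvd_diff add.commute)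
  hence "?p dvd m\<^sup>2 + 1" by (simp only: int_dvd_int_iff)
  then obtain k where k: "m\<^sup>2 + 1 = ?p * k" by blast
  define c :: "'p padic" where "c = of_nat m"
  have c_le: "padic_abs c \<le> 1" by (simp add: c_def padic_abs_of_nat_le_1)
  have "c\<^sup>2 + 1 = of_nat k * of_nat ?p"
    using arg_cong[OF k, of "of_nat :: nat \<Rightarrow> 'p padic"]
    by (simp add: c_def mult.commute add.commute)
  moreover have "padic_abs (of_nat k * of_nat ?p :: 'p padic) < 1"
    using p3 by (intro padic_abs_mult_less_1 padic_abs_of_nat_le_1) (simp add: padic_abs_prime)
  ultimately have c: "padic_abs (c\<^sup>2 + 1) < 1" by simp
  have "padic_abs (- c - 1) = 1" using c by (intro abs_diff_E one_E) simp
  hence "padic_abs (1 + c) = 1" using padic_abs_uminus[of "- c - 1"] by (simp del: padic_abs_uminus)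
  hence "padic_abs (- (2 * (1 + c))) = 1"
    using abs_2 by (simp add: padic_abs_mult del: distrib_left_numeral)
  moreover have "padic_abs ((2 + 1) * (c\<^sup>2 + 1)) < 1"
    using c abs_2 by (intro padic_abs_mult_less_1 padic_abs_add_le) simp_all
  ultimately have "padic_abs (- (2 * (1 + c)) + (2 + 1) * (c\<^sup>2 + 1)) = 1"
    using padic_abs_add_dominant[of "(2 + 1) * (c\<^sup>2 + 1)" "- (2 * (1 + c))"] by simp
  hence deriv: "padic_abs (3 * c\<^sup>2 - 2 * c + 1) = 1" by (simp add: algebra_simps)
  have "padic_abs ((c - a) * (c\<^sup>2 + 1)) < 1"
    using c c_le E_set_abs[OF a] by (intro padic_abs_mult_less_1 padic_abs_diff_le) simp_all
  then obtain x where x: "padic_abs (x - c) < 1" "poly (fixpoint_cubic a b) x = 0"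
    using hensel[OF cubic_integral c_le cubic_small cubic_deriv_unit] c_le deriv by blast
  have x_le: "padic_abs x \<le> 1" using padic_abs_add_le[of "x - c" 1 c] x(1) c_le by simp
  have "padic_abs ((x + c) * (x - c)) < 1"
    using x_le c_le x(1) by (intro padic_abs_mult_less_1 padic_abs_add_le)
  from padic_abs_add_less[OF this c] have x1: "padic_abs (x\<^sup>2 + 1) < 1"
    by (simp add: algebra_simps power2_eq_square)
  have "padic_abs (x - a) = 1" by (rule abs_diff_E[OF x1 a])
  moreover have "(x - a) * (x\<^sup>2 + 1) = (b\<^sup>2 - 1) * - (x * (1 - a * x))"
    using x(2) unfolding poly_fixpoint_cubic by (simp add: add_eq_0_iff2)
  ultimately have "padic_abs (x\<^sup>2 + 1) = padic_abs (b\<^sup>2 - 1) * padic_abs (x * (1 - a * x))"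
    by (metis mult_1 padic_abs_mult padic_abs_uminus)
  moreover have "padic_abs (x * (1 - a * x)) \<le> 1"
    using x_le E_set_abs[OF a] by (intro padic_abs_mult_le_1 padic_abs_diff_le) simp_all
  ultimately have "x \<in> K_set b x0" by (simp add: K_set_eq mult_left_le)
  thus ?thesis using x(2) by (auto simp: g_fixed_iff)
qed

theorem R_nonempty_iff: "R_set a b x0 \<noteq> {} \<longleftrightarrow> [CARD('p) = 1] (mod 4)"
proof -
  have "R_set a b x0 \<noteq> {} \<longleftrightarrow> QuadRes (int CARD('p)) (- 1)"
  proof
    assume "R_set a b x0 \<noteq> {}"
    then obtain x where "(g_map a b ^^ 0) (Fin x) \<in> Fin ` K_set b x0" unfolding R_set_def by blast
    hence "padic_abs (x\<^sup>2 + 1) < 1" using delta(2) by (auto simp: K_set_eq)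
    thus "QuadRes (int CARD('p)) (- 1)" by (rule QuadRes_minus_one_if_padic)
  next
    assume "QuadRes (int CARD('p)) (- 1)"
    then obtain x where x: "x \<in> K_set b x0" "g_map a b (Fin x) = Fin x"
      using fixed_point_in_K by blast
    have "(g_map a b ^^ n) (Fin x) = Fin x" for n by (induction n) (simp_all add: x(2))
    thus "R_set a b x0 \<noteq> {}" using x(1) by (auto simp: R_set_def)
  qed
  thus ?thesis using QuadRes_minus_one_iff[OF prime_card[where 'a = 'p]] p3 by simp
qed

end

theorem theorem4p2:
  fixes a b x0 :: "'p::prime_card padic"
  assumes "CARD('p) \<ge> 3"
    and "a \<in> E_set" and "b \<in> E_set" and "b \<noteq> 1"
    and "x0 = (THE x. x \<in> E_set \<and> g_map a b (Fin x) = Fin x)"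
  shows "(\<exists>!x. x \<in> E_set \<and> g_map a b (Fin x) = Fin x) \<and>
    basin a b x0 = UNIV - R_set a b x0 \<and>
    (R_set a b x0 \<noteq> {} \<longleftrightarrow> [CARD('p) = 1] (mod 4))"
proof -
  interpret g_system a b using assms(1-4) by unfold_locales
  interpret g_system_fixed a b x0
    using theI'[OF ex1_fixed_point] assms(5) by unfold_locales simp_all
  show ?thesis using ex1_fixed_point basin_eq R_nonempty_iff by blast
qed

end
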